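(* Let $W$ be a finite reflection group acting on $V=\mathbb{R}^n$ with fundamental chamber $B$. Let $\mathcal{S},\mathcal{S}_1,\dots,\mathcal{S}_r\subseteq W$ and $\mathbf{a}\in B$. Suppose that $P^{\mathcal{S}}(\mathbf{a})$ and $P^{\mathcal{S}_i}(\mathbf{a})$, $1\le i\le r$, are $W$-matroid polytopes. Then $\Theta=\{\mathcal{S}_i\}_{i=1}^r$ is an $\mathbf{a}$-subdivision of $\mathcal{S}$ if and only if $\Theta$ is a persistent subdivision of $\mathcal{S}$.
   Context: $W$ is a finite group generated by orthogonal reflections of $V=\mathbb{R}^n$, with root system $\Phi$; $B$ is a fixed open chamber, i.e. a connected component of the complement of the hyperplanes $\alpha^\perp$, $\alpha\in\Phi$. For nonempty $\mathcal{S}\subseteq W$ and $\mathbf{a}\in B$, the orbit polytope is $P^{\mathcal{S}}(\mathbf{a})=\mathrm{conv}(\mathcal{S}\cdot\mathbf{a})$. A polytope is a generalized $W$-permutahedron if all of its edges are parallel to roots of $W$. An orbit polytope $P^{\mathcal{S}}(\mathbf{a})$ that is a generalized $W$-permutahedron is called a $W$-matroid polytope. (Known fact, due to Borovik–Gelfand–White: for fixed $\mathcal{S}$, whether $P^{\mathcal{S}}(\mathbf{a})$ is a $W$-matroid polytope does not depend on $\mathbf{a}\in B$.) A collection of $d$-dimensional polytopes $\{Q_i\}_{i=1}^r$ is a subdivision of a $d$-dimensional polytope $P$ if $\bigcup_i Q_i=P$ and for all $i,j$, $Q_i\cap Q_j$ is a (possibly empty) face of both $Q_i$ and $Q_j$.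 A collection $\Theta=\{\mathcal{S}_i\}_{i=1}^r$ of subsets of $W$ is an $\mathbf{a}$-subdivision of $\mathcal{S}$ if $\{P^{\mathcal{S}_i}(\mathbf{a})\}_{i=1}^r$ is a subdivision of $P^{\mathcal{S}}(\mathbf{a})$; it is a persistent subdivision of $\mathcal{S}$ if it is an $\mathbf{a}'$-subdivision of $\mathcal{S}$ for every $\mathbf{a}'\in B$. *)

theory Defs
  imports "HOL-Analysis.Analysis"
begin

definition reflection :: "real ^ 'n \<Rightarrow> real ^ 'n \<Rightarrow> real ^ 'n" where
  "reflection \<alpha> x = x - (2 * (x \<bullet> \<alpha>) / (\<alpha> \<bullet> \<alpha>)) *\<^sub>R \<alpha>"

definition transformation_group :: "(real ^ 'n \<Rightarrow> real ^ 'n) set \<Rightarrow> bool" where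
  "transformation_group G \<longleftrightarrow>
     id \<in> G \<and> (\<forall>g\<in>G. bij g \<and> inv g \<in> G) \<and> (\<forall>g\<in>G. \<forall>h\<in>G. g \<circ> h \<in> G)"

text \<open>For a set \<open>R\<close> of nonzero vectors this is the smallest group of transformations
  containing the reflections in the members of \<open>R\<close>; the family over which the hull
  intersects is nonempty, since the set of all bijections belongs to it.\<close>

definition reflection_group :: "(real ^ 'n) set \<Rightarrow> (real ^ 'n \<Rightarrow> real ^ 'n) set" where
  "reflection_group R = transformation_group hull (reflection ` R)"

definition finite_reflection_group :: "(real ^ 'n \<Rightarrow> real ^ 'n) set \<Rightarrow> bool" where
  "finite_reflection_group W \<longleftrightarrow> finite W \<and> (\<exists>R. 0 \<notin> R \<and> W = reflection_group R)"

text \<open>Root systems are neither required to be crystallographic nor to span the space, so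
  every finite reflection group, essential or not, has one.\<close>

definition root_system :: "(real ^ 'n) set \<Rightarrow> bool" where
  "root_system \<Phi> \<longleftrightarrow>
     finite \<Phi> \<and> 0 \<notin> \<Phi> \<and>
     (\<forall>\<alpha>\<in>\<Phi>. \<Phi> \<inter> span {\<alpha>} = {\<alpha>, - \<alpha>}) \<and>
     (\<forall>\<alpha>\<in>\<Phi>. reflection \<alpha> ` \<Phi> = \<Phi>)"

definition root_system_of :: "(real ^ 'n \<Rightarrow> real ^ 'n) set \<Rightarrow> (real ^ 'n) set \<Rightarrow> bool" where
  "root_system_of W \<Phi> \<longleftrightarrow> root_system \<Phi> \<and> W = reflection_group \<Phi>"

definition open_chamber :: "(real ^ 'n) set \<Rightarrow> (real ^ 'n) set \<Rightarrow> bool" where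
  "open_chamber \<Phi> B \<longleftrightarrow> B \<in> components (UNIV - (\<Union>\<alpha>\<in>\<Phi>. {x. \<alpha> \<bullet> x = 0}))"

definition orbit_polytope :: "(real ^ 'n \<Rightarrow> real ^ 'n) set \<Rightarrow> real ^ 'n \<Rightarrow> (real ^ 'n) set" where
  "orbit_polytope S a = convex hull ((\<lambda>w. w a) ` S)"

definition generalized_permutahedron :: "(real ^ 'n) set \<Rightarrow> (real ^ 'n) set \<Rightarrow> bool" where
  "generalized_permutahedron \<Phi> P \<longleftrightarrow>
     polytope P \<and>
     (\<forall>e. e edge_of P \<longrightarrow> (\<exists>\<alpha>\<in>\<Phi>. affine_parallel (affine hull e) (span {\<alpha>})))"

definition matroid_polytope ::
  "(real ^ 'n \<Rightarrow> real ^ 'n) set \<Rightarrow> (real ^ 'n) set \<Rightarrow> (real ^ 'n) set \<Rightarrow> (real ^ 'n) set \<Rightarrow> bool" where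
  "matroid_polytope W \<Phi> B P \<longleftrightarrow>
     (\<exists>S a. S \<noteq> {} \<and> S \<subseteq> W \<and> a \<in> B \<and> P = orbit_polytope S a) \<and>
     generalized_permutahedron \<Phi> P"

definition subdivision :: "nat \<Rightarrow> (nat \<Rightarrow> (real ^ 'n) set) \<Rightarrow> (real ^ 'n) set \<Rightarrow> bool" where
  "subdivision r Q P \<longleftrightarrow>
     polytope P \<and>
     (\<forall>i\<in>{1..r}. polytope (Q i) \<and> aff_dim (Q i) = aff_dim P) \<and>
     (\<Union>i\<in>{1..r}. Q i) = P \<and>
     (\<forall>i\<in>{1..r}. \<forall>j\<in>{1..r}. Q i \<inter> Q j face_of Q i \<and> Q i \<inter> Q j face_of Q j)"

definition orbit_subdivision ::
  "real ^ 'n \<Rightarrow> nat \<Rightarrow> (nat \<Rightarrow> (real ^ 'n \<Rightarrow> real ^ 'n) set) \<Rightarrow> (real ^ 'n \<Rightarrow> real ^ 'n) set \<Rightarrow> bool" where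
  "orbit_subdivision a r \<Theta> S \<longleftrightarrow>
     subdivision r (\<lambda>i. orbit_polytope (\<Theta> i) a) (orbit_polytope S a)"

definition persistent_subdivision ::
  "(real ^ 'n) set \<Rightarrow> nat \<Rightarrow> (nat \<Rightarrow> (real ^ 'n \<Rightarrow> real ^ 'n) set) \<Rightarrow> (real ^ 'n \<Rightarrow> real ^ 'n) set \<Rightarrow> bool" where
  "persistent_subdivision B r \<Theta> S \<longleftrightarrow> (\<forall>a'\<in>B. orbit_subdivision a' r \<Theta> S)"

end

theory Submission
  imports Defs
begin

text \<open>
  Call two realizations of a labelled polytope normally equivalent if every linear form is
  maximized by the same labels in both, that is, if their normal fans agree once the cones are
  labelled by the vertices. The proof has two halves.

  The first half shows that moving the base point inside the chamber \<open>B\<close> gives normally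
  equivalent realizations of a \<open>W\<close>-matroid polytope (\<open>maximizers_constant_on_chamber\<close>). If \<open>w a\<close>
  does not maximize \<open>c\<close>, then an edge at \<open>w a\<close> improves \<open>c\<close>. Its direction is a root and its ends
  have equal norm, so it leads to \<open>s\<^sub>\<alpha> w a\<close>. Since \<open>W\<close> acts freely on the orbits of
  points of \<open>B\<close> (\<open>regular_stabilizer_trivial\<close>), the label of the other end is \<open>s\<^sub>\<alpha> w\<close> itself;
  and since roots keep their signs on \<open>B\<close>, the same reflection improves \<open>c\<close> at every other base
  point.

  The second half is a statement about polytopes only: replacing a subdivided polytope and its
  cells by normally equivalent ones, with vertices in convex position, again gives a subdivision
  (locale \<open>subdivision_deformation\<close>). The danger is that disjoint cells may collide, which no
  pairwise argument excludes. Instead, the deformed cells are glued along their common labels,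
  and the result is compared with the deformed polytope like a covering space with its base. The
  points over \<open>x\<close> are the sheets: the label sets of the minimal faces around \<open>x\<close> in the various
  cells. Tangent cones depend on the labelled normal fans only, and around each face they fit
  together as they do in the given subdivision, so every sheet continues uniquely to nearby
  points. Hence the number of sheets is constant on the polytope, and it is one at a vertex. So
  each point lies in some cell, and two cells containing it share its minimal face. This gives
  the covering as well as the intersections in common faces.
\<close>

section \<open>Groups generated by reflections\<close>

lemma reflection_linear: "linear (reflection \<alpha>)"
  unfolding reflection_def
  by (rule linearI) (simp_all add: inner_add_left algebra_simps add_divide_distrib)

lemma reflection_root: "\<alpha> \<noteq> 0 \<Longrightarrow> reflection \<alpha> \<alpha> = - \<alpha>"
  by (simp add: reflection_def scaleR_2)

lemma reflection_involution: "reflection \<alpha> (reflection \<alpha> x) = x"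
  by (cases "\<alpha> = 0") (simp_all add: reflection_def inner_diff_left algebra_simps)

lemma inner_reflection: "reflection \<alpha> x \<bullet> reflection \<alpha> y = x \<bullet> y"
  by (cases "\<alpha> = 0")
    (simp_all add: reflection_def inner_diff_left inner_diff_right inner_commute algebra_simps)

lemma orthogonal_reflection: "orthogonal_transformation (reflection \<alpha>)"
  by (simp add: orthogonal_transformation_def reflection_linear inner_reflection)

lemma reflection_conjugate:
  assumes g: "orthogonal_transformation g"
  shows "g (reflection \<alpha> x) = reflection (g \<alpha>) (g x)"
proof -
  have "linear g" "\<And>x y. g x \<bullet> g y = x \<bullet> y"
    using g by (auto simp: orthogonal_transformation_def)
  then show ?thesis
    by (simp add: reflection_def linear_diff linear_scale)
qed

lemma transformation_group_isometries_fixing: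
  "transformation_group {g :: real ^ 'n \<Rightarrow> real ^ 'n. orthogonal_transformation g \<and> g ` \<Phi> = \<Phi>}"
proof -
  have "inv g ` \<Phi> = \<Phi>" if "orthogonal_transformation g" "g ` \<Phi> = \<Phi>" for g :: "real ^ 'n \<Rightarrow> real ^ 'n"
    using that by (metis bij_is_inj image_inv_f_f orthogonal_transformation_bij)
  moreover have "(g \<circ> h) ` \<Phi> = \<Phi>" if "g ` \<Phi> = \<Phi>" "h ` \<Phi> = \<Phi>" for g h :: "real ^ 'n \<Rightarrow> real ^ 'n"
    using that by (metis image_comp)
  ultimately show ?thesis
    unfolding transformation_group_def
    by (simp add: orthogonal_transformation_id id_def orthogonal_transformation_bij
        orthogonal_transformation_inv orthogonal_transformation_compose)
qed

lemma reflection_group_isometry: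
  assumes "root_system \<Phi>" "g \<in> reflection_group \<Phi>"
  shows "orthogonal_transformation g" "g ` \<Phi> = \<Phi>"
proof -
  have "reflection_group \<Phi> \<subseteq> {g. orthogonal_transformation g \<and> g ` \<Phi> = \<Phi>}"
    unfolding reflection_group_def
    using assms(1) transformation_group_isometries_fixing [of \<Phi>]
    by (intro hull_minimal) (auto simp: root_system_def orthogonal_reflection)
  then show "orthogonal_transformation g" "g ` \<Phi> = \<Phi>"
    using assms(2) by auto
qed

lemma transformation_group_Inter:
  assumes "G \<in> \<F>" "\<And>G. G \<in> \<F> \<Longrightarrow> transformation_group G"
  shows "transformation_group (\<Inter>\<F>)"
  unfolding transformation_group_def
proof (intro conjI ballI InterI)
  show "bij g" if "g \<in> \<Inter>\<F>" for g
    using assms that unfolding transformation_group_def by (meson InterD)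
qed (use assms(2) in \<open>unfold transformation_group_def, meson InterD\<close>)+

lemma transformation_group_reflection_group: "transformation_group (reflection_group R)"
proof -
  let ?\<F> = "{G. transformation_group G \<and> reflection ` R \<subseteq> G}"
  have "transformation_group {g :: real ^ 'n \<Rightarrow> real ^ 'n. bij g}"
    unfolding transformation_group_def by (simp add: bij_imp_bij_inv bij_comp)
  moreover have "reflection ` R \<subseteq> {g. bij g}"
    using orthogonal_reflection orthogonal_transformation_bij by blast
  ultimately have "{g. bij g} \<in> ?\<F>"
    by blast
  moreover have "transformation_group G" if "G \<in> ?\<F>" for G
    using that by blast
  ultimately have "transformation_group (\<Inter>?\<F>)"
    by (rule transformation_group_Inter)
  then show ?thesis
    by (simp add: reflection_group_def hull_def)
qed

section \<open>Simple systems and freeness on regular points\<close>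

definition positive_roots :: "(real ^ 'n) set \<Rightarrow> real ^ 'n \<Rightarrow> (real ^ 'n) set" where
  "positive_roots \<Phi> a = {\<alpha> \<in> \<Phi>. \<alpha> \<bullet> a > 0}"

definition nonneg_comb :: "(real ^ 'n) set \<Rightarrow> (real ^ 'n) set" where
  "nonneg_comb D = {x. \<exists>f. (\<forall>\<delta>\<in>D. f \<delta> \<ge> 0) \<and> x = (\<Sum>\<delta>\<in>D. f \<delta> *\<^sub>R \<delta>)}"

text \<open>
  A simple system is taken to be an irredundant set of positive roots that spans the cone of all
  positive roots, which exists by minimality of the cardinality.
\<close>

definition simple_system :: "(real ^ 'n) set \<Rightarrow> real ^ 'n \<Rightarrow> (real ^ 'n) set \<Rightarrow> bool" where
  "simple_system \<Phi> a \<Delta> \<longleftrightarrow>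
     \<Delta> \<subseteq> positive_roots \<Phi> a \<and> positive_roots \<Phi> a \<subseteq> nonneg_comb \<Delta> \<and>
     (\<forall>\<alpha>\<in>\<Delta>. \<alpha> \<notin> nonneg_comb (\<Delta> - {\<alpha>}))"

lemma nonneg_comb_remove:
  assumes fin: "finite D" and "\<alpha> \<in> D" and \<alpha>: "\<alpha> \<in> nonneg_comb (D - {\<alpha>})"
  shows "nonneg_comb D \<subseteq> nonneg_comb (D - {\<alpha>})"
proof
  fix x assume "x \<in> nonneg_comb D"
  then obtain f where f: "\<And>\<delta>. \<delta> \<in> D \<Longrightarrow> f \<delta> \<ge> 0" and x: "x = (\<Sum>\<delta>\<in>D. f \<delta> *\<^sub>R \<delta>)"
    by (auto simp: nonneg_comb_def)
  obtain g where g: "\<And>\<delta>. \<delta> \<in> D - {\<alpha>} \<Longrightarrow> g \<delta> \<ge> 0" and \<alpha>g: "\<alpha> = (\<Sum>\<delta>\<in>D - {\<alpha>}. g \<delta> *\<^sub>R \<delta>)"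
    using \<alpha> unfolding nonneg_comb_def by blast
  have "x = f \<alpha> *\<^sub>R \<alpha> + (\<Sum>\<delta>\<in>D - {\<alpha>}. f \<delta> *\<^sub>R \<delta>)"
    unfolding x by (rule sum.remove [OF fin \<open>\<alpha> \<in> D\<close>])
  also have "f \<alpha> *\<^sub>R \<alpha> = (\<Sum>\<delta>\<in>D - {\<alpha>}. (f \<alpha> * g \<delta>) *\<^sub>R \<delta>)"
    by (subst \<alpha>g) (simp add: scaleR_sum_right)
  finally have "x = (\<Sum>\<delta>\<in>D - {\<alpha>}. (f \<alpha> * g \<delta> + f \<delta>) *\<^sub>R \<delta>)"
    by (simp add: sum.distrib scaleR_left_distrib)
  moreover have "\<forall>\<delta>\<in>D - {\<alpha>}. f \<alpha> * g \<delta> + f \<delta> \<ge> 0"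
    using f g \<open>\<alpha> \<in> D\<close> by auto
  ultimately show "x \<in> nonneg_comb (D - {\<alpha>})"
    unfolding nonneg_comb_def by (intro CollectI exI conjI)
qed

lemma generator_in_nonneg_comb:
  assumes "finite D" "\<alpha> \<in> D" shows "\<alpha> \<in> nonneg_comb D"
proof -
  have "\<alpha> = (\<Sum>\<delta>\<in>D. (if \<delta> = \<alpha> then 1 else 0) *\<^sub>R \<delta>)"
    using assms by (simp add: if_distrib [where f = "\<lambda>c. c *\<^sub>R _"] sum.delta' cong: if_cong)
  then show ?thesis
    unfolding nonneg_comb_def by (intro CollectI exI conjI) auto
qed

lemma simple_system_exists:
  assumes "finite \<Phi>"
  obtains \<Delta> where "simple_system \<Phi> a \<Delta>"
proof -
  let ?P = "positive_roots \<Phi> a"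
  let ?gen = "\<lambda>D. D \<subseteq> ?P \<and> ?P \<subseteq> nonneg_comb D"
  have fin: "finite ?P"
    using assms by (simp add: positive_roots_def)
  then have "?gen ?P"
    using generator_in_nonneg_comb by blast
  then obtain \<Delta> where \<Delta>: "?gen \<Delta>" and least: "\<And>D. ?gen D \<Longrightarrow> card \<Delta> \<le> card D"
    using ex_has_least_nat [of ?gen ?P card] by blast
  have fin\<Delta>: "finite \<Delta>"
    using \<Delta> fin finite_subset by blast
  have "\<alpha> \<notin> nonneg_comb (\<Delta> - {\<alpha>})" if "\<alpha> \<in> \<Delta>" for \<alpha>
  proof
    assume "\<alpha> \<in> nonneg_comb (\<Delta> - {\<alpha>})"
    then have "?gen (\<Delta> - {\<alpha>})"
      using \<Delta> nonneg_comb_remove [OF fin\<Delta> that] by blast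
    then show False
      using least [of "\<Delta> - {\<alpha>}"] card_Diff1_less [OF fin\<Delta> that] by simp
  qed
  then show thesis
    using \<Delta> that unfolding simple_system_def by blast
qed

lemma root_negative:
  assumes "root_system \<Phi>" "\<alpha> \<in> \<Phi>" shows "- \<alpha> \<in> \<Phi>"
  using assms unfolding root_system_def by blast

lemma root_multiple:
  assumes "root_system \<Phi>" "\<alpha> \<in> \<Phi>" "k *\<^sub>R \<alpha> \<in> \<Phi>" shows "k *\<^sub>R \<alpha> = \<alpha> \<or> k *\<^sub>R \<alpha> = - \<alpha>"
proof -
  have "k *\<^sub>R \<alpha> \<in> \<Phi> \<inter> span {\<alpha>}"
    using assms by (auto simp: span_mul span_base)
  then show ?thesis
    using assms unfolding root_system_def by blast
qed

lemma root_sign: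
  assumes "root_system \<Phi>" "\<alpha> \<in> \<Phi>" "\<And>\<alpha>. \<alpha> \<in> \<Phi> \<Longrightarrow> \<alpha> \<bullet> a \<noteq> 0"
  shows "\<alpha> \<in> positive_roots \<Phi> a \<or> - \<alpha> \<in> positive_roots \<Phi> a"
  using assms root_negative [of \<Phi> \<alpha>] unfolding positive_roots_def
  by (auto simp: not_less order.order_iff_strict)

text \<open>
  If \<open>s\<^sub>\<alpha> \<beta>\<close> were negative, then a multiple of \<open>\<alpha>\<close> would be the sum of the positive roots
  \<open>\<beta>\<close> and \<open>- s\<^sub>\<alpha> \<beta>\<close>. Expanding both in simple roots either exhibits \<open>\<alpha>\<close> as a nonnegative
  combination of the other simple roots, or makes a nonnegative combination of positive roots
  nonpositive on \<open>a\<close>, which kills all coefficients except that of \<open>\<alpha>\<close>.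
\<close>

lemma simple_reflection_permutes_positive:
  assumes rs: "root_system \<Phi>" and reg: "\<And>\<alpha>. \<alpha> \<in> \<Phi> \<Longrightarrow> \<alpha> \<bullet> a \<noteq> 0"
    and ss: "simple_system \<Phi> a \<Delta>"
    and \<alpha>: "\<alpha> \<in> \<Delta>" and \<beta>: "\<beta> \<in> positive_roots \<Phi> a" "\<beta> \<noteq> \<alpha>"
  shows "reflection \<alpha> \<beta> \<in> positive_roots \<Phi> a"
proof (rule ccontr)
  assume neg: "reflection \<alpha> \<beta> \<notin> positive_roots \<Phi> a"
  have \<Delta>P: "\<Delta> \<subseteq> positive_roots \<Phi> a"
    using ss unfolding simple_system_def by blast
  then have "\<Delta> \<subseteq> \<Phi>"
    unfolding positive_roots_def by blast
  then have fin: "finite \<Delta>"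
    using rs finite_subset unfolding root_system_def by blast
  have \<alpha>P: "\<alpha> \<in> positive_roots \<Phi> a" and \<alpha>\<Phi>: "\<alpha> \<in> \<Phi>" and \<alpha>a: "\<alpha> \<bullet> a > 0"
    using \<alpha> \<Delta>P unfolding positive_roots_def by blast+
  have \<alpha>0: "\<alpha> \<noteq> 0"
    using \<alpha>a by auto
  define \<gamma> where "\<gamma> = - reflection \<alpha> \<beta>"
  have "reflection \<alpha> \<beta> \<in> \<Phi>"
    using rs \<alpha>\<Phi> \<beta>(1) unfolding root_system_def positive_roots_def by blast
  then have \<gamma>: "\<gamma> \<in> positive_roots \<Phi> a"
    using root_sign [OF rs _ reg] neg \<gamma>_def by blast
  define k where "k = 2 * (\<beta> \<bullet> \<alpha>) / (\<alpha> \<bullet> \<alpha>)"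
  have sum: "\<beta> + \<gamma> = k *\<^sub>R \<alpha>"
    by (simp add: \<gamma>_def reflection_def k_def)
  obtain f where f: "\<And>\<delta>. \<delta> \<in> \<Delta> \<Longrightarrow> f \<delta> \<ge> 0" and \<beta>f: "\<beta> = (\<Sum>\<delta>\<in>\<Delta>. f \<delta> *\<^sub>R \<delta>)"
    using \<beta>(1) ss unfolding simple_system_def nonneg_comb_def by blast
  obtain g where g: "\<And>\<delta>. \<delta> \<in> \<Delta> \<Longrightarrow> g \<delta> \<ge> 0" and \<gamma>g: "\<gamma> = (\<Sum>\<delta>\<in>\<Delta>. g \<delta> *\<^sub>R \<delta>)"
    using \<gamma> ss unfolding simple_system_def nonneg_comb_def by blast
  define m where "m = k - f \<alpha> - g \<alpha>"
  have f_split: "\<beta> = f \<alpha> *\<^sub>R \<alpha> + (\<Sum>\<delta>\<in>\<Delta> - {\<alpha>}. f \<delta> *\<^sub>R \<delta>)"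
    unfolding \<beta>f by (rule sum.remove [OF fin \<alpha>])
  have g_split: "\<gamma> = g \<alpha> *\<^sub>R \<alpha> + (\<Sum>\<delta>\<in>\<Delta> - {\<alpha>}. g \<delta> *\<^sub>R \<delta>)"
    unfolding \<gamma>g by (rule sum.remove [OF fin \<alpha>])
  have "m *\<^sub>R \<alpha> = \<beta> + \<gamma> - f \<alpha> *\<^sub>R \<alpha> - g \<alpha> *\<^sub>R \<alpha>"
    by (simp add: sum m_def algebra_simps)
  also have "\<dots> = (\<Sum>\<delta>\<in>\<Delta> - {\<alpha>}. f \<delta> *\<^sub>R \<delta>) + (\<Sum>\<delta>\<in>\<Delta> - {\<alpha>}. g \<delta> *\<^sub>R \<delta>)"
    using f_split g_split by (simp add: algebra_simps)
  finally have m: "m *\<^sub>R \<alpha> = (\<Sum>\<delta>\<in>\<Delta> - {\<alpha>}. (f \<delta> + g \<delta>) *\<^sub>R \<delta>)"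
    by (simp add: sum.distrib scaleR_left_distrib)
  show False
  proof (cases "m > 0")
    case True
    have "\<alpha> = (1 / m) *\<^sub>R (m *\<^sub>R \<alpha>)"
      using True by simp
    also have "\<dots> = (\<Sum>\<delta>\<in>\<Delta> - {\<alpha>}. ((f \<delta> + g \<delta>) / m) *\<^sub>R \<delta>)"
      unfolding m by (simp add: scaleR_sum_right divide_inverse mult.commute)
    finally have "\<alpha> = (\<Sum>\<delta>\<in>\<Delta> - {\<alpha>}. ((f \<delta> + g \<delta>) / m) *\<^sub>R \<delta>)" .
    moreover have "\<forall>\<delta>\<in>\<Delta> - {\<alpha>}. (f \<delta> + g \<delta>) / m \<ge> 0"
      using f g True by auto
    ultimately have "\<alpha> \<in> nonneg_comb (\<Delta> - {\<alpha>})"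
      unfolding nonneg_comb_def by (intro CollectI exI conjI)
    then show False
      using ss \<alpha> unfolding simple_system_def by blast
  next
    case False
    have nn: "(f \<delta> + g \<delta>) * (\<delta> \<bullet> a) \<ge> 0" if "\<delta> \<in> \<Delta> - {\<alpha>}" for \<delta>
      using that f g \<Delta>P unfolding positive_roots_def by (intro mult_nonneg_nonneg) auto
    have "(\<Sum>\<delta>\<in>\<Delta> - {\<alpha>}. (f \<delta> + g \<delta>) * (\<delta> \<bullet> a)) = m * (\<alpha> \<bullet> a)"
      by (metis (no_types, lifting) inner_scaleR_left inner_sum_left m sum.cong)
    also have "\<dots> \<le> 0"
      using False \<alpha>a by (simp add: mult_nonpos_nonneg)
    finally have "(\<Sum>\<delta>\<in>\<Delta> - {\<alpha>}. (f \<delta> + g \<delta>) * (\<delta> \<bullet> a)) = 0"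
      using nn by (meson antisym sum_nonneg)
    then have zero: "(f \<delta> + g \<delta>) * (\<delta> \<bullet> a) = 0" if "\<delta> \<in> \<Delta> - {\<alpha>}" for \<delta>
      using that nn fin by (subst (asm) sum_nonneg_eq_0_iff) auto
    have "f \<delta> = 0" if "\<delta> \<in> \<Delta> - {\<alpha>}" for \<delta>
    proof -
      have "\<delta> \<bullet> a > 0"
        using that \<Delta>P unfolding positive_roots_def by blast
      then show ?thesis
        using zero [OF that] f [of \<delta>] g [of \<delta>] that by auto
    qed
    then have \<beta>\<alpha>: "\<beta> = f \<alpha> *\<^sub>R \<alpha>"
      using f_split by simp
    have "\<beta> = \<alpha> \<or> \<beta> = - \<alpha>"
      using root_multiple [OF rs \<alpha>\<Phi>, of "f \<alpha>"] \<beta>(1) unfolding \<beta>\<alpha> [symmetric] positive_roots_def by blast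
    then show False
      using \<beta> \<alpha>a unfolding positive_roots_def by auto
  qed
qed

definition reflection_word :: "(real ^ 'n) list \<Rightarrow> real ^ 'n \<Rightarrow> real ^ 'n" where
  "reflection_word \<alpha>s = foldr (\<circ>) (map reflection \<alpha>s) id"

lemma reflection_word_simps [simp]:
  "reflection_word [] = id"
  "reflection_word (\<alpha> # \<alpha>s) = reflection \<alpha> \<circ> reflection_word \<alpha>s"
  by (simp_all add: reflection_word_def)

lemma reflection_word_append:
  "reflection_word (\<alpha>s @ \<beta>s) = reflection_word \<alpha>s \<circ> reflection_word \<beta>s"
  by (induction \<alpha>s) (simp_all add: comp_assoc)

lemma orthogonal_reflection_word: "orthogonal_transformation (reflection_word \<alpha>s)"
  by (induction \<alpha>s)
    (simp_all add: orthogonal_transformation_id id_def orthogonal_reflection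
      orthogonal_transformation_compose [unfolded o_def] o_def)

lemma reflection_word_rev: "reflection_word (rev \<alpha>s) \<circ> reflection_word \<alpha>s = id"
  by (induction \<alpha>s) (auto simp: reflection_word_append fun_eq_iff reflection_involution)

lemma inv_reflection_word: "inv (reflection_word \<alpha>s) = reflection_word (rev \<alpha>s)"
  by (metis reflection_word_rev rev_rev_ident inv_unique_comp)

text \<open>
  A positive root that is not simple has positive inner product with some simple root. The
  reflection in the latter keeps it positive and lowers its value at \<open>a\<close>, so conjugation brings
  the reflection down to a simple one.
\<close>

lemma positive_reflection_is_simple_word:
  assumes rs: "root_system \<Phi>" and reg: "\<And>\<alpha>. \<alpha> \<in> \<Phi> \<Longrightarrow> \<alpha> \<bullet> a \<noteq> 0"
    and ss: "simple_system \<Phi> a \<Delta>" and "\<beta> \<in> positive_roots \<Phi> a"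
  shows "\<exists>\<alpha>s. set \<alpha>s \<subseteq> \<Delta> \<and> reflection \<beta> = reflection_word \<alpha>s"
proof -
  let ?P = "positive_roots \<Phi> a"
  have fin: "finite ?P"
    using rs by (simp add: root_system_def positive_roots_def)
  define height where "height \<beta> = card {\<gamma> \<in> ?P. \<gamma> \<bullet> a < \<beta> \<bullet> a}" for \<beta>
  show ?thesis
    using \<open>\<beta> \<in> ?P\<close>
  proof (induction "height \<beta>" arbitrary: \<beta> rule: less_induct)
    case less
    show ?case
    proof (cases "\<beta> \<in> \<Delta>")
      case True
      then show ?thesis
        by (intro exI [of _ "[\<beta>]"]) simp
    next
      case False
      obtain f where f: "\<And>\<delta>. \<delta> \<in> \<Delta> \<Longrightarrow> f \<delta> \<ge> 0" and \<beta>f: "\<beta> = (\<Sum>\<delta>\<in>\<Delta>. f \<delta> *\<^sub>R \<delta>)"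
        using less.prems ss unfolding simple_system_def nonneg_comb_def by blast
      have "\<beta> \<bullet> \<beta> = (\<Sum>\<delta>\<in>\<Delta>. f \<delta> * (\<delta> \<bullet> \<beta>))"
        by (subst \<beta>f) (simp add: inner_sum_left)
      moreover have "\<beta> \<bullet> \<beta> > 0"
        using less.prems by (auto simp: positive_roots_def)
      ultimately have "\<not> (\<Sum>\<delta>\<in>\<Delta>. f \<delta> * (\<delta> \<bullet> \<beta>)) \<le> 0"
        by simp
      then obtain \<alpha> where \<alpha>: "\<alpha> \<in> \<Delta>" and "\<not> f \<alpha> * (\<alpha> \<bullet> \<beta>) \<le> 0"
        using sum_nonpos [of \<Delta> "\<lambda>\<delta>. f \<delta> * (\<delta> \<bullet> \<beta>)"] by blast
      then have "\<alpha> \<bullet> \<beta> > 0"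
        using f [OF \<alpha>] by (auto simp: mult_le_0_iff not_le)
      then have pos: "\<beta> \<bullet> \<alpha> > 0"
        by (simp add: inner_commute)
      have \<alpha>P: "\<alpha> \<in> ?P"
        using \<alpha> ss unfolding simple_system_def by blast
      let ?\<gamma> = "reflection \<alpha> \<beta>"
      have \<gamma>P: "?\<gamma> \<in> ?P"
        using simple_reflection_permutes_positive [OF rs reg ss \<alpha> less.prems] False \<alpha> by blast
      have lower: "?\<gamma> \<bullet> a < \<beta> \<bullet> a"
        using pos \<alpha>P by (auto simp: positive_roots_def reflection_def inner_diff_left
            intro!: divide_pos_pos mult_pos_pos)
      have "{\<delta> \<in> ?P. \<delta> \<bullet> a < ?\<gamma> \<bullet> a} \<subset> {\<delta> \<in> ?P. \<delta> \<bullet> a < \<beta> \<bullet> a}"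
        using lower \<gamma>P by (intro psubsetI) auto
      then have "height ?\<gamma> < height \<beta>"
        unfolding height_def using fin by (intro psubset_card_mono) auto
      then obtain \<alpha>s where \<alpha>s: "set \<alpha>s \<subseteq> \<Delta>" "reflection ?\<gamma> = reflection_word \<alpha>s"
        using less.hyps \<gamma>P by blast
      have "reflection \<beta> x = reflection_word (\<alpha> # \<alpha>s @ [\<alpha>]) x" for x
        using reflection_conjugate [OF orthogonal_reflection, of \<alpha> ?\<gamma> "reflection \<alpha> x"]
        by (simp add: reflection_word_append reflection_involution \<alpha>s(2) [symmetric])
      then show ?thesis
        using \<alpha> \<alpha>s(1) by (intro exI [of _ "\<alpha> # \<alpha>s @ [\<alpha>]"]) auto
    qed
  qed
qed

lemma reflection_uminus: "reflection (- \<alpha>) = reflection \<alpha>"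
  by (simp add: reflection_def fun_eq_iff)

lemma reflection_group_simple_words:
  assumes rs: "root_system \<Phi>" and reg: "\<And>\<alpha>. \<alpha> \<in> \<Phi> \<Longrightarrow> \<alpha> \<bullet> a \<noteq> 0"
    and ss: "simple_system \<Phi> a \<Delta>" and "g \<in> reflection_group \<Phi>"
  shows "\<exists>\<alpha>s. set \<alpha>s \<subseteq> \<Delta> \<and> g = reflection_word \<alpha>s"
proof -
  let ?G = "{reflection_word \<alpha>s | \<alpha>s. set \<alpha>s \<subseteq> \<Delta>}"
  have "reflection \<alpha> \<in> ?G" if "\<alpha> \<in> \<Phi>" for \<alpha>
    using root_sign [OF rs that reg] positive_reflection_is_simple_word [OF rs reg ss]
    by (metis (mono_tags, lifting) mem_Collect_eq reflection_uminus)
  moreover have "transformation_group ?G"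
    unfolding transformation_group_def
  proof (intro conjI ballI)
    show "id \<in> ?G"
      by (intro CollectI exI [of _ "[]"]) simp
    show "bij g" if "g \<in> ?G" for g
      using that orthogonal_reflection_word orthogonal_transformation_bij by blast
    show "inv g \<in> ?G" if g: "g \<in> ?G" for g
    proof -
      obtain \<alpha>s where "set \<alpha>s \<subseteq> \<Delta>" "g = reflection_word \<alpha>s"
        using g by blast
      then show ?thesis
        by (intro CollectI exI [of _ "rev \<alpha>s"]) (simp add: inv_reflection_word)
    qed
    show "g \<circ> h \<in> ?G" if gh: "g \<in> ?G" "h \<in> ?G" for g h
    proof -
      obtain \<alpha>s \<beta>s where "set \<alpha>s \<subseteq> \<Delta>" "g = reflection_word \<alpha>s" "set \<beta>s \<subseteq> \<Delta>" "h = reflection_word \<beta>s"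
        using gh by blast
      then show ?thesis
        by (intro CollectI exI [of _ "\<alpha>s @ \<beta>s"]) (simp add: reflection_word_append)
    qed
  qed
  ultimately have "reflection_group \<Phi> \<subseteq> ?G"
    unfolding reflection_group_def by (intro hull_minimal) auto
  then show ?thesis
    using assms(4) by blast
qed

text \<open>
  When a positive root turns negative along a word of simple reflections, the letter where this
  happens belongs to the only positive root that its reflection makes negative. This is the
  exchange condition in the form used below.
\<close>

lemma sign_change_in_simple_word:
  assumes rs: "root_system \<Phi>" and reg: "\<And>\<alpha>. \<alpha> \<in> \<Phi> \<Longrightarrow> \<alpha> \<bullet> a \<noteq> 0"
    and ss: "simple_system \<Phi> a \<Delta>" and "set \<alpha>s \<subseteq> \<Delta>"
    and "\<gamma> \<in> positive_roots \<Phi> a" "reflection_word \<alpha>s \<gamma> \<notin> positive_roots \<Phi> a"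
  shows "\<exists>\<beta>s \<beta> \<gamma>s. \<alpha>s = \<beta>s @ \<beta> # \<gamma>s \<and> reflection_word \<gamma>s \<gamma> = \<beta>"
  using assms(4-6)
proof (induction \<alpha>s)
  case Nil
  then show ?case by simp
next
  case (Cons \<alpha> \<alpha>s)
  show ?case
  proof (cases "reflection_word \<alpha>s \<gamma> \<in> positive_roots \<Phi> a")
    case True
    then have "reflection_word \<alpha>s \<gamma> = \<alpha>"
      using Cons.prems simple_reflection_permutes_positive [OF rs reg ss] by auto
    then show ?thesis
      by (intro exI [of _ "[]"] exI [of _ \<alpha>] exI [of _ \<alpha>s]) simp
  next
    case False
    then obtain \<beta>s \<beta> \<gamma>s where "\<alpha>s = \<beta>s @ \<beta> # \<gamma>s" "reflection_word \<gamma>s \<gamma> = \<beta>"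
      using Cons by auto
    then show ?thesis
      by (intro exI [of _ "\<alpha> # \<beta>s"] exI [of _ \<beta>] exI [of _ \<gamma>s]) simp
  qed
qed

text \<open>
  The deletion argument. The last letter sends its own root to a negative root, which the rest of
  the word must make positive again; the place where this happens is conjugate to the last letter,
  and both letters cancel. Iterating empties the word.
\<close>

lemma simple_word_preserving_positive_roots:
  assumes rs: "root_system \<Phi>" and reg: "\<And>\<alpha>. \<alpha> \<in> \<Phi> \<Longrightarrow> \<alpha> \<bullet> a \<noteq> 0"
    and ss: "simple_system \<Phi> a \<Delta>" and "set \<alpha>s \<subseteq> \<Delta>"
    and "\<And>\<gamma>. \<gamma> \<in> positive_roots \<Phi> a \<Longrightarrow> reflection_word \<alpha>s \<gamma> \<in> positive_roots \<Phi> a"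
  shows "reflection_word \<alpha>s = id"
  using assms(4,5)
proof (induction "length \<alpha>s" arbitrary: \<alpha>s rule: less_induct)
  case less
  show ?case
  proof (cases \<alpha>s rule: rev_cases)
    case Nil
    then show ?thesis by simp
  next
    case (snoc \<alpha>s' \<alpha>)
    have \<alpha>: "\<alpha> \<in> positive_roots \<Phi> a" "\<alpha> \<noteq> 0"
      using less.prems(1) ss unfolding snoc simple_system_def positive_roots_def by auto
    have "reflection_word \<alpha>s \<alpha> = - reflection_word \<alpha>s' \<alpha>"
      using orthogonal_reflection_word [of \<alpha>s'] \<alpha>(2)
      by (simp add: snoc reflection_word_append reflection_root orthogonal_transformation_def
          linear_neg)
    then have "reflection_word \<alpha>s' \<alpha> \<notin> positive_roots \<Phi> a"
      using less.prems(2) [OF \<alpha>(1)] by (auto simp: positive_roots_def)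
    then obtain \<beta>s \<beta> \<gamma>s where split: "\<alpha>s' = \<beta>s @ \<beta> # \<gamma>s" and \<beta>: "reflection_word \<gamma>s \<alpha> = \<beta>"
      using sign_change_in_simple_word [OF rs reg ss _ \<alpha>(1), of \<alpha>s'] less.prems(1) snoc
      by (metis Un_subset_iff set_append)
    have "reflection_word \<alpha>s x = reflection_word (\<beta>s @ \<gamma>s) x" for x
      using reflection_conjugate [OF orthogonal_reflection_word, of \<gamma>s \<alpha> x] \<beta>
      by (simp add: snoc split reflection_word_append reflection_involution)
    then have eq: "reflection_word \<alpha>s = reflection_word (\<beta>s @ \<gamma>s)"
      by blast
    show ?thesis
      unfolding eq using less.prems eq snoc split by (intro less.hyps) auto
  qed
qed

text \<open>
  An element fixing a regular point \<open>a\<close> preserves the signs of all roots at \<open>a\<close>. This freeness is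
  what allows the equation \<open>u a = s\<^sub>\<alpha> (w a)\<close> at one point of a chamber to be transported to
  every other point.
\<close>

lemma regular_stabilizer_trivial:
  assumes rs: "root_system \<Phi>" and reg: "\<And>\<alpha>. \<alpha> \<in> \<Phi> \<Longrightarrow> \<alpha> \<bullet> a \<noteq> 0"
    and g: "g \<in> reflection_group \<Phi>" and ga: "g a = a"
  shows "g = id"
proof -
  obtain \<Delta> where ss: "simple_system \<Phi> a \<Delta>"
    using simple_system_exists rs unfolding root_system_def by blast
  then obtain \<alpha>s where \<alpha>s: "set \<alpha>s \<subseteq> \<Delta>" "g = reflection_word \<alpha>s"
    using reflection_group_simple_words [OF rs reg _ g] by blast
  have "g \<gamma> \<in> positive_roots \<Phi> a" if "\<gamma> \<in> positive_roots \<Phi> a" for \<gamma>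
  proof -
    have "g \<gamma> \<bullet> a = \<gamma> \<bullet> a"
      using reflection_group_isometry(1) [OF rs g] ga unfolding orthogonal_transformation_def by metis
    then show ?thesis
      using that reflection_group_isometry(2) [OF rs g] unfolding positive_roots_def by auto
  qed
  then show ?thesis
    using simple_word_preserving_positive_roots [OF rs reg ss \<alpha>s(1)] \<alpha>s(2) by simp
qed

section \<open>Improving edges\<close>

text \<open>
  A connected set on which a linear form takes both signs meets its zero hyperplane.
\<close>

lemma open_chamber_same_side:
  assumes B: "open_chamber \<Phi> B" and ab: "a \<in> B" "b \<in> B" and \<alpha>: "\<alpha> \<in> \<Phi>"
  shows "\<alpha> \<bullet> a \<noteq> 0" and "0 < \<alpha> \<bullet> a \<longleftrightarrow> 0 < \<alpha> \<bullet> b"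
proof -
  let ?R = "UNIV - (\<Union>\<alpha>\<in>\<Phi>. {x. \<alpha> \<bullet> x = 0})"
  have "B \<subseteq> ?R" and conn: "connected B"
    using B in_components_subset in_components_connected unfolding open_chamber_def by blast+
  then have nz: "\<alpha> \<bullet> x \<noteq> 0" if "x \<in> B" for x
    using that \<alpha> by blast
  then show "\<alpha> \<bullet> a \<noteq> 0"
    using ab by blast
  have "\<not> (\<alpha> \<bullet> x < 0 \<and> 0 < \<alpha> \<bullet> y)" if "x \<in> B" "y \<in> B" for x y
    using connected_ivt_hyperplane [OF conn that, of \<alpha> 0] nz by force
  then show "0 < \<alpha> \<bullet> a \<longleftrightarrow> 0 < \<alpha> \<bullet> b"
    using nz ab by (metis linorder_neqE_linordered_idom)
qed

text \<open>
  An extreme point of a polytope with more than one point lies on the relative boundary, hence in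
  a facet; descending through facets ends at dimension one.
\<close>

lemma polytope_edge_at_extreme_point:
  fixes P :: "'a::euclidean_space set"
  assumes "polytope P" "v extreme_point_of P" "P \<noteq> {v}"
  obtains e where "e edge_of P" "v \<in> e"
proof -
  have "\<exists>e. e edge_of P \<and> v \<in> e"
    using assms
  proof (induction "nat (aff_dim P)" arbitrary: P rule: less_induct)
    case (less P)
    have vP: "v \<in> P"
      using less.prems(2) by (simp add: extreme_point_of_def)
    have "aff_dim P \<noteq> 0"
      using vP less.prems(3) by (auto simp: aff_dim_eq_0)
    moreover have "aff_dim P \<noteq> -1"
      using vP aff_dim_empty [of P] by auto
    ultimately have dim: "aff_dim P \<ge> 1"
      using aff_dim_geq [of P] by linarith
    show ?case
    proof (cases "aff_dim P = 1")
      case True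
      then show ?thesis
        using less.prems vP by (intro exI [of _ P]) (simp add: edge_of_def face_of_refl polytope_imp_convex)
    next
      case False
      have "v \<notin> rel_interior P"
        using extreme_point_not_in_REL_INTERIOR less.prems by blast
      then have "v \<in> rel_frontier P"
        using vP by (simp add: rel_frontier_def closure_subset [THEN subsetD])
      then obtain F where F: "F facet_of P" "v \<in> F"
        using less.prems(1) polytope_imp_polyhedron rel_frontier_of_polyhedron by blast
      then have face: "F face_of P" and dimF: "aff_dim F = aff_dim P - 1"
        by (auto simp: facet_of_def)
      have "polytope F"
        using face less.prems(1) face_of_polytope_polytope by blast
      moreover have "v extreme_point_of F"
        using face F(2) less.prems(2) extreme_point_of_face by blast
      moreover have "F \<noteq> {v}"
        using dim False dimF by auto
      ultimately obtain e where "e edge_of F" "v \<in> e"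
        using less.hyps [of F] dim dimF by auto
      then show ?thesis
        using face face_of_trans unfolding edge_of_def by blast
    qed
  qed
  then show thesis
    using that by blast
qed

text \<open>
  The points of an orbit lie on a sphere, so each is the unique maximizer of the linear form that
  it defines. This makes every generator of an orbit polytope a vertex.
\<close>

lemma sphere_unique_maximum:
  fixes v x :: "'a::real_inner"
  assumes "norm x \<le> norm v" "x \<noteq> v"
  shows "v \<bullet> x < v \<bullet> v"
proof -
  have "0 < (v - x) \<bullet> (v - x)"
    using assms(2) by simp
  also have "\<dots> = v \<bullet> v + x \<bullet> x - 2 * (v \<bullet> x)"
    by (simp add: inner_diff_left inner_diff_right inner_commute)
  also have "x \<bullet> x \<le> v \<bullet> v"
    using assms(1) by (simp add: norm_le)
  finally show ?thesis by simp
qed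

lemma convex_hull_norm_le:
  assumes "\<And>x. x \<in> X \<Longrightarrow> norm x \<le> \<rho>" "x \<in> convex hull X"
  shows "norm x \<le> \<rho>"
proof -
  have "convex hull X \<subseteq> cball 0 \<rho>"
    using assms(1) by (intro hull_minimal) auto
  then show ?thesis
    using assms(2) by auto
qed

text \<open>
  The step of the simplex algorithm, with the shadow-vertex rule: tilting \<open>c\<close> towards \<open>v\<close> by the
  critical amount \<open>M\<close> produces a face that contains \<open>v\<close> and further vertices, and on which \<open>c\<close> is
  larger than at \<open>v\<close> everywhere else. Every edge of this face at \<open>v\<close> therefore improves \<open>c\<close>.
\<close>

lemma improving_edge_of_inscribed_polytope:
  fixes X :: "'a::euclidean_space set"
  assumes fin: "finite X" and sph: "\<And>x. x \<in> X \<Longrightarrow> norm x = \<rho>" and v: "v \<in> X"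
    and y: "y \<in> X" "c \<bullet> v < c \<bullet> y"
  obtains e u where "e edge_of convex hull X" "v \<in> e" "u \<in> e" "u \<in> X" "c \<bullet> v < c \<bullet> u"
proof -
  let ?P = "convex hull X"
  have below: "v \<bullet> x < v \<bullet> v" if "x \<in> ?P" "x \<noteq> v" for x
    using sphere_unique_maximum convex_hull_norm_le [OF _ that(1)] sph v that(2) by (metis order_refl)
  define slope where "slope x = (c \<bullet> x - c \<bullet> v) / (v \<bullet> v - v \<bullet> x)" for x
  define M where "M = Max (slope ` (X - {v}))"
  have yv: "y \<in> X - {v}"
    using y by auto
  have le_M: "slope x \<le> M" if "x \<in> X - {v}" for x
    unfolding M_def using that fin by (intro Max_ge) auto
  have "M \<in> slope ` (X - {v})"
    unfolding M_def using fin yv by (intro Max_in) auto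
  then obtain z where z: "z \<in> X - {v}" and slope_z: "slope z = M"
    by blast
  have X_P: "x \<in> ?P" if "x \<in> X" for x
    using that by (rule hull_inc)
  have "slope y > 0"
    using y below [OF X_P, of y] yv unfolding slope_def by (intro divide_pos_pos) auto
  then have M_pos: "M > 0"
    using le_M [OF yv] by simp
  define d where "d = c + M *\<^sub>R v"
  have max_X: "d \<bullet> x \<le> d \<bullet> v" if "x \<in> X" for x
  proof (cases "x = v")
    case False
    then have "slope x \<le> M" "v \<bullet> v - v \<bullet> x > 0"
      using le_M that below [OF X_P, of x] by auto
    then show ?thesis
      by (simp add: slope_def d_def inner_add_left divide_le_eq algebra_simps)
  qed simp
  have "?P \<subseteq> {x. d \<bullet> x \<le> d \<bullet> v}"
    using max_X by (intro hull_minimal) (auto simp: convex_halfspace_le)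
  then have max_P: "d \<bullet> x \<le> d \<bullet> v" if "x \<in> ?P" for x
    using that by blast
  define F where "F = ?P \<inter> {x. d \<bullet> x = d \<bullet> v}"
  have F: "F face_of ?P"
    unfolding F_def using max_P by (intro face_of_Int_supporting_hyperplane_le) auto
  have up: "c \<bullet> v < c \<bullet> x" if "x \<in> F" "x \<noteq> v" for x
  proof -
    have "c \<bullet> x - c \<bullet> v = M * (v \<bullet> v - v \<bullet> x)"
      using that(1) by (simp add: F_def d_def inner_add_left algebra_simps)
    moreover have "v \<bullet> v - v \<bullet> x > 0"
      using below [of x] that by (simp add: F_def)
    ultimately show ?thesis
      using M_pos by (metis diff_gt_0_iff_gt mult_pos_pos)
  qed
  have "v \<bullet> v - v \<bullet> z > 0"
    using below [OF X_P, of z] z by auto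
  then have "d \<bullet> z = d \<bullet> v"
    using slope_z by (simp add: slope_def d_def inner_add_left divide_eq_eq algebra_simps)
  then have zF: "z \<in> F"
    using z X_P by (simp add: F_def)
  have vP: "v \<in> ?P"
    using v by (rule X_P)
  have "?P \<inter> {x. v \<bullet> x = v \<bullet> v} face_of ?P"
    using below by (intro face_of_Int_supporting_hyperplane_le) (auto simp: less_imp_le, metis less_eq_real_def)
  moreover have "?P \<inter> {x. v \<bullet> x = v \<bullet> v} = {v}"
    using vP below by fastforce
  ultimately have "v extreme_point_of ?P"
    by (simp add: face_of_singleton)
  then have "v extreme_point_of F"
    using extreme_point_of_face [OF F] vP by (simp add: F_def)
  moreover have polyF: "polytope F"
    using F face_of_polytope_polytope polytope_convex_hull fin by blast
  ultimately obtain e where e: "e edge_of F" "v \<in> e"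
    using polytope_edge_at_extreme_point [of F v] zF z by blast
  then have eF: "e face_of F" and "aff_dim e = 1"
    by (auto simp: edge_of_def)
  have "compact e" "convex e"
    using eF polyF face_of_polytope_polytope polytope_imp_compact polytope_imp_convex by blast+
  then have "e = convex hull {x. x extreme_point_of e}"
    using Krein_Milman_Minkowski by blast
  moreover have "e \<noteq> {v}"
    using \<open>aff_dim e = 1\<close> by auto
  ultimately have "\<not> {x. x extreme_point_of e} \<subseteq> {v}"
    by (metis convex_hull_singleton e(2) empty_iff hull_mono subset_singleton_iff convex_hull_empty)
  then obtain u where u: "u extreme_point_of e" "u \<noteq> v"
    by blast
  have eP: "e face_of ?P"
    using eF F face_of_trans by blast
  then have "u extreme_point_of ?P"
    using extreme_point_of_face [OF eP] u(1) by blast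
  then have "u \<in> X"
    by (rule extreme_point_of_convex_hull)
  moreover have "u \<in> e"
    using u(1) by (simp add: extreme_point_of_def)
  moreover have "e edge_of ?P"
    using eP \<open>aff_dim e = 1\<close> by (simp add: edge_of_def)
  moreover have "c \<bullet> v < c \<bullet> u"
    using up [of u] u(2) \<open>u \<in> e\<close> eF face_of_imp_subset by blast
  ultimately show thesis
    using that e(2) by blast
qed

section \<open>The labelled normal fan is constant on the chamber\<close>

text \<open>
  Maximizers are recorded as labels rather than as points of the space, so that they can be
  compared between polytopes with the same labels and different base points.
\<close>

definition maximizers :: "('l \<Rightarrow> 'a::real_inner) \<Rightarrow> 'l set \<Rightarrow> 'a \<Rightarrow> 'l set" where
  "maximizers p U c = {w \<in> U. \<forall>v\<in>U. c \<bullet> p v \<le> c \<bullet> p w}"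

lemma maximizers_nonempty:
  assumes "finite U" "U \<noteq> {}"
  shows "maximizers p U c \<noteq> {}"
proof -
  have "Max ((\<lambda>w. c \<bullet> p w) ` U) \<in> (\<lambda>w. c \<bullet> p w) ` U"
    using assms by (intro Max_in) auto
  then obtain w where "w \<in> U" "c \<bullet> p w = Max ((\<lambda>w. c \<bullet> p w) ` U)"
    by force
  then have "w \<in> maximizers p U c"
    using assms by (simp add: maximizers_def)
  then show ?thesis
    by blast
qed

lemma parallel_equal_norm_reflection:
  assumes "y - x \<in> span {\<alpha>}" "norm x = norm y" "x \<noteq> y"
  shows "y = reflection \<alpha> x"
proof -
  obtain k where "y - x = k *\<^sub>R \<alpha>"
    using assms(1) by (auto simp: span_singleton)
  then have y: "y = x + k *\<^sub>R \<alpha>"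
    by (simp add: algebra_simps)
  have k0: "k \<noteq> 0" "\<alpha> \<noteq> 0"
    using assms(3) y by auto
  have "x \<bullet> x = y \<bullet> y"
    using assms(2) by (simp add: norm_eq)
  then have "k * (2 * (x \<bullet> \<alpha>) + k * (\<alpha> \<bullet> \<alpha>)) = 0"
    by (simp add: y inner_add_left inner_add_right inner_commute algebra_simps)
  then have "2 * (x \<bullet> \<alpha>) = - k * (\<alpha> \<bullet> \<alpha>)"
    using k0 by simp
  then have "2 * (x \<bullet> \<alpha>) / (\<alpha> \<bullet> \<alpha>) = - k"
    using k0 by (simp add: divide_eq_eq)
  then show ?thesis
    by (simp add: reflection_def y)
qed

lemma affine_parallel_span_diff:
  assumes "affine_parallel (affine hull e) (span {\<alpha>})" "x \<in> e" "y \<in> e"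
  shows "y - x \<in> span {\<alpha>}"
proof -
  obtain b where b: "span {\<alpha>} = (+) b ` (affine hull e)"
    using assms(1) unfolding affine_parallel_def by blast
  have "b + y \<in> span {\<alpha>}" "b + x \<in> span {\<alpha>}"
    unfolding b using assms(2,3) hull_inc [of _ e affine] by blast+
  then show ?thesis
    using span_diff by fastforce
qed

locale chamber_of_reflection_group =
  fixes W :: "(real ^ 'n \<Rightarrow> real ^ 'n) set" and \<Phi> B :: "(real ^ 'n) set"
  assumes root_system: "root_system \<Phi>" and W: "W = reflection_group \<Phi>"
    and finite_W: "finite W" and chamber: "open_chamber \<Phi> B"
begin

lemma root_nonzero_on_chamber: "a \<in> B \<Longrightarrow> \<alpha> \<in> \<Phi> \<Longrightarrow> \<alpha> \<bullet> a \<noteq> 0"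
  using open_chamber_same_side(1) [OF chamber] by blast

lemma root_sign_on_chamber:
  "a \<in> B \<Longrightarrow> b \<in> B \<Longrightarrow> \<alpha> \<in> \<Phi> \<Longrightarrow> 0 < \<alpha> \<bullet> a \<longleftrightarrow> 0 < \<alpha> \<bullet> b"
  using open_chamber_same_side(2) [OF chamber] by blast

lemma isometry: "w \<in> W \<Longrightarrow> orthogonal_transformation w"
  using reflection_group_isometry [OF root_system] W by blast

lemma norm_orbit: "w \<in> W \<Longrightarrow> norm (w x) = norm x"
  using isometry orthogonal_transformation by blast

lemma transformation_group_W: "transformation_group W"
  unfolding W by (rule transformation_group_reflection_group)

lemma reflection_in_W: "\<alpha> \<in> \<Phi> \<Longrightarrow> reflection \<alpha> \<in> W"
  unfolding W reflection_group_def by (intro hull_inc imageI)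

lemma eq_at_chamber_point:
  assumes "u \<in> W" "w \<in> W" "a \<in> B" "u a = w a"
  shows "u = w"
proof -
  have inv: "inv w \<in> W" "bij w"
    using transformation_group_W assms(2) by (auto simp: transformation_group_def)
  then have "inv w \<circ> u \<in> W"
    using transformation_group_W assms(1) by (auto simp: transformation_group_def)
  moreover have "(inv w \<circ> u) a = a"
    using assms(4) inv(2) by (simp add: bij_is_inj)
  ultimately have "inv w \<circ> u = id"
    using regular_stabilizer_trivial [OF root_system] root_nonzero_on_chamber [OF assms(3)] W by metis
  then show ?thesis
    using inv(2) by (metis bij_is_surj comp_assoc comp_id id_comp surj_iff)
qed

lemma sign_at_orbit_point:
  assumes "a \<in> B" "b \<in> B" "\<alpha> \<in> \<Phi>" "w \<in> W"
  shows "w a \<bullet> \<alpha> \<noteq> 0" and "0 < w a \<bullet> \<alpha> \<longleftrightarrow> 0 < w b \<bullet> \<alpha>"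
proof -
  have orth: "orthogonal_transformation w"
    using isometry assms(4) by blast
  obtain \<beta> where \<beta>: "\<beta> \<in> \<Phi>" "\<alpha> = w \<beta>"
    using reflection_group_isometry(2) [OF root_system] assms W by blast
  have eq: "w x \<bullet> \<alpha> = \<beta> \<bullet> x" for x
    using orth unfolding \<beta>(2) orthogonal_transformation_def by (metis inner_commute)
  show "w a \<bullet> \<alpha> \<noteq> 0"
    unfolding eq by (rule root_nonzero_on_chamber [OF assms(1) \<beta>(1)])
  show "0 < w a \<bullet> \<alpha> \<longleftrightarrow> 0 < w b \<bullet> \<alpha>"
    unfolding eq by (rule root_sign_on_chamber [OF assms(1,2) \<beta>(1)])
qed

text \<open>
  Whether a reflection increases \<open>c\<close> is decided by the signs of \<open>c\<close> and of \<open>w a\<close> on the root, and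
  the latter is the sign of a root at \<open>a\<close>, the same in the whole chamber.
\<close>

lemma reflection_improves_throughout_chamber:
  assumes "a \<in> B" "b \<in> B" "\<alpha> \<in> \<Phi>" "w \<in> W" "c \<bullet> w a < c \<bullet> reflection \<alpha> (w a)"
  shows "c \<bullet> w b < c \<bullet> reflection \<alpha> (w b)"
proof -
  have "\<alpha> \<noteq> 0"
    using assms(3) root_system by (auto simp: root_system_def)
  then have "\<not> \<alpha> \<bullet> \<alpha> < 0" "\<alpha> \<bullet> \<alpha> > 0"
    by (simp_all add: not_less)
  then have iff: "c \<bullet> x < c \<bullet> reflection \<alpha> x \<longleftrightarrow> (x \<bullet> \<alpha>) * (c \<bullet> \<alpha>) < 0" for x
    by (simp add: reflection_def inner_diff_right divide_less_0_iff mult_less_0_iff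
        zero_less_mult_iff, blast)
  show ?thesis
    using sign_at_orbit_point [OF assms(1-4)] sign_at_orbit_point(1) [OF assms(2,1,3,4)] assms(5)
    unfolding iff by (auto simp: mult_less_0_iff)
qed

lemma convex_position_orbit:
  assumes "a \<in> B" "w \<in> W" "U \<subseteq> W" "w a \<in> convex hull ((\<lambda>u. u a) ` U)"
  shows "w \<in> U"
proof (rule ccontr)
  assume "w \<notin> U"
  have "(w a) \<bullet> u a < w a \<bullet> w a" if "u \<in> U" for u
  proof (rule sphere_unique_maximum)
    show "norm (u a) \<le> norm (w a)"
      using that assms norm_orbit by (metis order_refl subsetD)
    show "u a \<noteq> w a"
      using that assms \<open>w \<notin> U\<close> eq_at_chamber_point by (metis subsetD)
  qed
  then have "convex hull ((\<lambda>u. u a) ` U) \<subseteq> {x. w a \<bullet> x < w a \<bullet> w a}"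
    by (intro hull_minimal) (auto simp: convex_halfspace_lt)
  then show False
    using assms(4) by auto
qed

text \<open>
  A label that does not maximize \<open>c\<close> at \<open>a\<close> admits an improving edge. The edge is parallel to a
  root and joins two points of a sphere, so it reflects \<open>w a\<close> to \<open>u a\<close>; freeness turns this into
  an identity in the group, and the same reflection improves \<open>c\<close> at \<open>b\<close>.
\<close>

lemma maximizers_subset_throughout_chamber:
  assumes U: "U \<subseteq> W" and a: "a \<in> B" and b: "b \<in> B"
    and gp: "generalized_permutahedron \<Phi> (orbit_polytope U a)"
  shows "maximizers (\<lambda>w. w b) U c \<subseteq> maximizers (\<lambda>w. w a) U c"
proof
  fix w assume w: "w \<in> maximizers (\<lambda>w. w b) U c"
  then have wU: "w \<in> U"
    by (simp add: maximizers_def)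
  show "w \<in> maximizers (\<lambda>w. w a) U c"
  proof (rule ccontr)
    assume "w \<notin> maximizers (\<lambda>w. w a) U c"
    then obtain y where "y \<in> U" "c \<bullet> w a < c \<bullet> y a"
      using wU by (auto simp: maximizers_def not_le)
    moreover have "finite ((\<lambda>w. w a) ` U)"
      using finite_W U finite_subset by blast
    ultimately obtain e x where e: "e edge_of convex hull ((\<lambda>w. w a) ` U)" "w a \<in> e" "x \<in> e"
      and "x \<in> (\<lambda>w. w a) ` U" and up: "c \<bullet> w a < c \<bullet> x"
      using improving_edge_of_inscribed_polytope [of "(\<lambda>w. w a) ` U" "norm a" "w a" "y a" c]
        norm_orbit U wU by blast
    then obtain u where u: "u \<in> U" "x = u a"
      by blast
    obtain \<alpha> where \<alpha>: "\<alpha> \<in> \<Phi>" "affine_parallel (affine hull e) (span {\<alpha>})"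
      using gp e(1) unfolding generalized_permutahedron_def orbit_polytope_def by blast
    have "x - w a \<in> span {\<alpha>}"
      using affine_parallel_span_diff \<alpha>(2) e(2,3) by blast
    moreover have "norm (w a) = norm x"
      using u U wU norm_orbit by (metis subsetD)
    ultimately have x: "x = reflection \<alpha> (w a)"
      using parallel_equal_norm_reflection up by blast
    have "reflection \<alpha> \<circ> w \<in> W"
      using transformation_group_W reflection_in_W [OF \<alpha>(1)] U wU
      unfolding transformation_group_def by blast
    then have "u = reflection \<alpha> \<circ> w"
      using eq_at_chamber_point [OF _ _ a] u U x by auto
    then have "c \<bullet> w b < c \<bullet> u b"
      using reflection_improves_throughout_chamber [OF a b \<alpha>(1), of w c] up x subsetD [OF U wU]
      by auto
    then show False
      using w u(1) by (auto simp: maximizers_def)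
  qed
qed

text \<open>
  The inclusion above is an equality: a small tilt of \<open>c\<close> towards \<open>w a\<close> makes a maximizer \<open>w\<close> at
  \<open>a\<close> the unique one, so that it is also the maximizer at \<open>b\<close>, and the tilt can be made to vanish.
\<close>

lemma maximizers_constant_on_chamber:
  assumes U: "U \<subseteq> W" and a: "a \<in> B" and b: "b \<in> B"
    and gp: "generalized_permutahedron \<Phi> (orbit_polytope U a)"
  shows "maximizers (\<lambda>w. w b) U c = maximizers (\<lambda>w. w a) U c"
proof (intro subset_antisym maximizers_subset_throughout_chamber [OF assms] subsetI)
  fix w assume w: "w \<in> maximizers (\<lambda>w. w a) U c"
  then have wU: "w \<in> U"
    by (simp add: maximizers_def)
  have perturbed: "(c + \<epsilon> *\<^sub>R w a) \<bullet> v b \<le> (c + \<epsilon> *\<^sub>R w a) \<bullet> w b"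
    if \<epsilon>: "\<epsilon> > 0" and v: "v \<in> U" for \<epsilon> v
  proof -
    let ?d = "c + \<epsilon> *\<^sub>R w a"
    have less: "?d \<bullet> u a < ?d \<bullet> w a" if "u \<in> U" "u \<noteq> w" for u
    proof -
      have "u a \<noteq> w a"
        using eq_at_chamber_point [OF _ _ a] that U wU by blast
      then have "w a \<bullet> u a < w a \<bullet> w a"
        using norm_orbit that U wU by (metis order_refl sphere_unique_maximum subsetD)
      moreover have "c \<bullet> u a \<le> c \<bullet> w a"
        using w that(1) by (simp add: maximizers_def)
      ultimately show ?thesis
        using \<epsilon> by (simp add: inner_add_left add_le_less_mono)
    qed
    have "maximizers (\<lambda>w. w a) U ?d \<subseteq> {w}"
      using less wU by (force simp: maximizers_def)
    then have "maximizers (\<lambda>w. w b) U ?d \<subseteq> {w}"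
      using maximizers_subset_throughout_chamber [OF assms] by blast
    moreover have "maximizers (\<lambda>w. w b) U ?d \<noteq> {}"
      using U wU finite_W finite_subset by (intro maximizers_nonempty) auto
    ultimately have "w \<in> maximizers (\<lambda>w. w b) U ?d"
      by blast
    then show ?thesis
      using v by (simp add: maximizers_def)
  qed
  have "c \<bullet> v b \<le> c \<bullet> w b" if "v \<in> U" for v
  proof (rule tendsto_le [of "at_right (0::real)"])
    show "((\<lambda>\<epsilon>. (c + \<epsilon> *\<^sub>R w a) \<bullet> v b) \<longlongrightarrow> c \<bullet> v b) (at_right 0)"
      by (auto intro!: tendsto_eq_intros)
    show "((\<lambda>\<epsilon>. (c + \<epsilon> *\<^sub>R w a) \<bullet> w b) \<longlongrightarrow> c \<bullet> w b) (at_right 0)"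
      by (auto intro!: tendsto_eq_intros)
    show "\<forall>\<^sub>F \<epsilon> in at_right 0. (c + \<epsilon> *\<^sub>R w a) \<bullet> v b \<le> (c + \<epsilon> *\<^sub>R w a) \<bullet> w b"
      using perturbed that by (auto simp: eventually_at_right_field intro: exI [of _ 1])
  qed simp
  then show "w \<in> maximizers (\<lambda>w. w b) U c"
    using wU by (simp add: maximizers_def)
qed

end

section \<open>Local structure of labelled polytopes\<close>

lemma hull_inner_le:
  fixes p :: "'l \<Rightarrow> 'a::euclidean_space"
  assumes "x \<in> convex hull (p ` U)" "\<And>v. v \<in> U \<Longrightarrow> c \<bullet> p v \<le> b"
  shows "c \<bullet> x \<le> b"
proof -
  have "convex hull (p ` U) \<subseteq> {x. c \<bullet> x \<le> b}"
    using assms(2) by (intro hull_minimal) (auto simp: convex_halfspace_le)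
  then show ?thesis
    using assms(1) by blast
qed

text \<open>
  For \<open>x\<close> in the polytope this is its normal cone.
\<close>

definition normals :: "('l \<Rightarrow> 'a::euclidean_space) \<Rightarrow> 'l set \<Rightarrow> 'a \<Rightarrow> 'a set" where
  "normals p U x = {c. \<forall>v\<in>U. c \<bullet> p v \<le> c \<bullet> x}"

text \<open>
  For \<open>x\<close> in the polytope these are the labels of the smallest face containing \<open>x\<close>.
\<close>

definition carrier :: "('l \<Rightarrow> 'a::euclidean_space) \<Rightarrow> 'l set \<Rightarrow> 'a \<Rightarrow> 'l set" where
  "carrier p U x = {w \<in> U. \<forall>c\<in>normals p U x. c \<bullet> p w = c \<bullet> x}"

text \<open>
  This is the cone of feasible directions at a relative interior point of the hull of the points
  labelled \<open>T\<close>. It is written in terms of maximizers to make visible that it is determined by the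
  labelled normal fan.
\<close>

definition tangent :: "('l \<Rightarrow> 'a::euclidean_space) \<Rightarrow> 'l set \<Rightarrow> 'l set \<Rightarrow> 'a set" where
  "tangent p U T = {h. \<forall>c. T \<subseteq> maximizers p U c \<longrightarrow> c \<bullet> h \<le> 0}"

text \<open>
  This is the carrier reached from a relative interior point of the hull of the points labelled
  \<open>T\<close> by a short step in a feasible direction \<open>h\<close>; again determined by the labelled normal fan.
\<close>

definition link :: "('l \<Rightarrow> 'a::euclidean_space) \<Rightarrow> 'l set \<Rightarrow> 'l set \<Rightarrow> 'a \<Rightarrow> 'l set" where
  "link p U T h =
     {w \<in> U. \<forall>c. T \<subseteq> maximizers p U c \<and> c \<bullet> h = 0 \<longrightarrow> w \<in> maximizers p U c}"

lemma normals_inner_le: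
  "c \<in> normals p U x \<Longrightarrow> y \<in> convex hull (p ` U) \<Longrightarrow> c \<bullet> y \<le> c \<bullet> x"
  by (rule hull_inner_le) (auto simp: normals_def)

lemma carrier_subset: "carrier p U x \<subseteq> U"
  by (auto simp: carrier_def)

text \<open>
  In a convex representation of \<open>x\<close>, a normal at \<open>x\<close> must attain its maximum at every point with
  nonzero weight.
\<close>

lemma in_hull_carrier:
  assumes fin: "finite U" and x: "x \<in> convex hull (p ` U)"
  shows "x \<in> convex hull (p ` carrier p U x)"
proof -
  obtain u where u: "\<And>y. y \<in> p ` U \<Longrightarrow> 0 \<le> u y" and u1: "sum u (p ` U) = 1"
    and ux: "(\<Sum>y\<in>p ` U. u y *\<^sub>R y) = x"
    using x fin by (auto simp: convex_hull_finite)
  let ?Y = "{y \<in> p ` U. u y \<noteq> 0}"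
  have "?Y \<subseteq> p ` carrier p U x"
  proof
    fix y assume y: "y \<in> ?Y"
    then obtain w where w: "w \<in> U" "y = p w"
      by blast
    have "c \<bullet> y = c \<bullet> x" if c: "c \<in> normals p U x" for c
    proof -
      have nonneg: "u z * (c \<bullet> x - c \<bullet> z) \<ge> 0" if "z \<in> p ` U" for z
        using that u c by (auto simp: normals_def)
      have "(\<Sum>z\<in>p ` U. u z * (c \<bullet> x - c \<bullet> z)) = (\<Sum>z\<in>p ` U. u z) * (c \<bullet> x) - (\<Sum>z\<in>p ` U. u z * (c \<bullet> z))"
        by (simp add: right_diff_distrib sum_subtractf sum_distrib_right)
      also have "(\<Sum>z\<in>p ` U. u z * (c \<bullet> z)) = c \<bullet> x"
        by (subst ux [symmetric]) (simp add: inner_sum_right)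
      finally have "(\<Sum>z\<in>p ` U. u z * (c \<bullet> x - c \<bullet> z)) = 0"
        using u1 by simp
      then have "u y * (c \<bullet> x - c \<bullet> y) = 0"
        using y fin nonneg by (subst (asm) sum_nonneg_eq_0_iff) auto
      then show ?thesis
        using y by simp
    qed
    then show "y \<in> p ` carrier p U x"
      using w by (auto simp: carrier_def)
  qed
  moreover have "x \<in> convex hull ?Y"
  proof -
    have "sum u ?Y = 1" "(\<Sum>y\<in>?Y. u y *\<^sub>R y) = x"
      unfolding u1 [symmetric] ux [symmetric] using fin by (auto intro: sum.mono_neutral_left)
    then show ?thesis
      using fin u by (auto simp: convex_hull_finite)
  qed
  ultimately show ?thesis
    using hull_mono by blast
qed

lemma normals_if_subset_maximizers:
  assumes "x \<in> convex hull (p ` T)" "T \<subseteq> maximizers p U c"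
  shows "c \<in> normals p U x"
proof -
  have "c \<bullet> p v \<le> c \<bullet> x" if "v \<in> U" for v
  proof -
    have "- c \<bullet> x \<le> - (c \<bullet> p v)"
      using that assms by (intro hull_inner_le [OF assms(1)]) (auto simp: maximizers_def)
    then show ?thesis by simp
  qed
  then show ?thesis
    by (simp add: normals_def)
qed

lemma normals_iff_carrier:
  assumes "finite U" "x \<in> convex hull (p ` U)"
  shows "c \<in> normals p U x \<longleftrightarrow> carrier p U x \<subseteq> maximizers p U c"
proof
  show "carrier p U x \<subseteq> maximizers p U c" if "c \<in> normals p U x"
    using that by (auto simp: carrier_def maximizers_def normals_def)
  show "c \<in> normals p U x" if "carrier p U x \<subseteq> maximizers p U c"
    using normals_if_subset_maximizers in_hull_carrier assms that by blast
qed

lemma carrier_eq_maximizers: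
  assumes "finite U" "x \<in> convex hull (p ` U)"
  shows "carrier p U x = {w \<in> U. \<forall>c\<in>normals p U x. w \<in> maximizers p U c}"
proof -
  have "carrier p U x \<noteq> {}"
    using in_hull_carrier [OF assms] by auto
  then obtain v where v: "v \<in> carrier p U x"
    by blast
  have "c \<bullet> p w = c \<bullet> x \<longleftrightarrow> w \<in> maximizers p U c" if "c \<in> normals p U x" "w \<in> U" for c w
    using that v by (force simp: carrier_def maximizers_def normals_def)
  then show ?thesis
    by (auto simp: carrier_def)
qed

text \<open>
  A relative interior point can be pushed slightly away from any of the generators labelled \<open>T\<close>, so
  a normal there is constant on them. The set \<open>T\<close> may be contained in several sets \<open>U\<close>, and the
  same point serves for all of them.
\<close>

lemma normals_at_rel_interior:
  assumes x: "x \<in> rel_interior (convex hull (p ` T))" and "T \<subseteq> U"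
  shows "normals p U x = {c. T \<subseteq> maximizers p U c}"
proof (intro subset_antisym subsetI CollectI)
  fix c w assume c: "c \<in> normals p U x" and w: "w \<in> T"
  have "p w \<in> convex hull (p ` T)"
    using w by (simp add: hull_inc)
  then obtain e where e: "e > 1" and y: "(1 - e) *\<^sub>R p w + e *\<^sub>R x \<in> convex hull (p ` T)"
    using x w convex_rel_interior_iff [of "convex hull (p ` T)" x] by auto
  have "c \<bullet> ((1 - e) *\<^sub>R p w + e *\<^sub>R x) \<le> c \<bullet> x"
    using y c \<open>T \<subseteq> U\<close> by (intro hull_inner_le [OF y]) (auto simp: normals_def)
  then have "(e - 1) * (c \<bullet> x - c \<bullet> p w) \<le> 0"
    by (simp add: inner_add_right algebra_simps)
  then have "c \<bullet> x \<le> c \<bullet> p w"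
    using e by (simp add: mult_le_0_iff)
  then show "w \<in> maximizers p U c"
    using c w \<open>T \<subseteq> U\<close> by (force simp: maximizers_def normals_def)
next
  fix c assume "c \<in> {c. T \<subseteq> maximizers p U c}"
  then show "c \<in> normals p U x"
    using normals_if_subset_maximizers x rel_interior_subset by blast
qed

lemma in_hull_if_rel_interior:
  "x \<in> rel_interior (convex hull (p ` T)) \<Longrightarrow> T \<subseteq> U \<Longrightarrow> x \<in> convex hull (p ` U)"
  by (meson hull_mono image_mono rel_interior_subset subsetD)

text \<open>
  Near \<open>x\<close> only the finitely many facet inequalities that are tight at \<open>x\<close> matter, and their
  normals belong to the normal cone.
\<close>

lemma eventually_near_polytope_point:
  fixes p :: "'l \<Rightarrow> 'a::euclidean_space"
  assumes fin: "finite U" and x: "x \<in> convex hull (p ` U)"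
  shows "\<forall>\<^sub>F h in nhds 0.
           (x + h \<in> convex hull (p ` U) \<longleftrightarrow> (\<forall>c\<in>normals p U x. c \<bullet> h \<le> 0)) \<and>
           (x + h \<in> convex hull (p ` U) \<longrightarrow>
             normals p U (x + h) = {c \<in> normals p U x. c \<bullet> h = 0})"
proof -
  let ?P = "convex hull (p ` U)"
  let ?feasible = "\<lambda>h. \<forall>c\<in>normals p U x. c \<bullet> h \<le> 0"
  have "polyhedron ?P"
    using fin by (simp add: polytope_imp_polyhedron polytope_convex_hull)
  then obtain \<H> where \<H>: "finite \<H>" "?P = \<Inter>\<H>"
    and half: "\<And>H. H \<in> \<H> \<Longrightarrow> \<exists>a b. a \<noteq> 0 \<and> H = {x. a \<bullet> x \<le> b}"
    unfolding polyhedron_def by metis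
  have "\<forall>\<^sub>F h in nhds 0. ?feasible h \<longrightarrow> x + h \<in> H" if "H \<in> \<H>" for H
    using half [OF that]
  proof (elim exE conjE)
    fix a b assume H: "H = {x. a \<bullet> x \<le> b}"
    have PH: "?P \<subseteq> H"
      using \<H>(2) that by blast
    show ?thesis
    proof (cases "a \<bullet> x < b")
      case True
      have "((\<lambda>h. a \<bullet> (x + h)) \<longlongrightarrow> a \<bullet> (x + 0)) (nhds 0)"
        by (intro tendsto_intros filterlim_ident)
      then have "\<forall>\<^sub>F h in nhds 0. a \<bullet> (x + h) < b"
        using True by (intro order_tendstoD(2)) auto
      then show ?thesis
        by eventually_elim (simp add: H)
    next
      case False
      then have "a \<bullet> x = b"
        using PH x H by force
      moreover have "p v \<in> H" if "v \<in> U" for v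
        using that PH hull_inc [of "p v" "p ` U" convex] by blast
      ultimately have "a \<in> normals p U x"
        by (simp add: normals_def H)
      then have "?feasible h \<longrightarrow> x + h \<in> H" for h
        using \<open>a \<bullet> x = b\<close> by (auto simp: H inner_add_right)
      then show ?thesis
        by simp
    qed
  qed
  then have "\<forall>\<^sub>F h in nhds 0. \<forall>H\<in>\<H>. ?feasible h \<longrightarrow> x + h \<in> H"
    by (intro eventually_ball_finite \<H>(1) ballI)
  then have enter: "\<forall>\<^sub>F h in nhds 0. ?feasible h \<longrightarrow> x + h \<in> ?P"
    unfolding \<H>(2) by eventually_elim blast
  \<comment> \<open>A step of double length stays inside as well; hence normals at its midpoint vanish on the step.\<close>
  have "((\<lambda>h::'a. 2 *\<^sub>R h) \<longlongrightarrow> 2 *\<^sub>R 0) (nhds 0)"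
    by (intro tendsto_intros filterlim_ident)
  then have enter2: "\<forall>\<^sub>F h in nhds 0. ?feasible (2 *\<^sub>R h) \<longrightarrow> x + 2 *\<^sub>R h \<in> ?P"
    using eventually_compose_filterlim [OF enter, of "\<lambda>h. 2 *\<^sub>R h"] by simp
  have feasible: "?feasible h" if "x + h \<in> ?P" for h
    using normals_inner_le that by (force simp: inner_add_right)
  show ?thesis
    using enter enter2
  proof eventually_elim
    case (elim h)
    have "normals p U (x + h) = {c \<in> normals p U x. c \<bullet> h = 0}" if h: "x + h \<in> ?P"
    proof (intro subset_antisym subsetI)
      fix c assume c: "c \<in> normals p U (x + h)"
      have "x + 2 *\<^sub>R h \<in> ?P"
        using elim(2) feasible [OF h] by auto
      then have "c \<bullet> (x + 2 *\<^sub>R h) \<le> c \<bullet> (x + h)"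
        using normals_inner_le c by blast
      moreover have "c \<bullet> x \<le> c \<bullet> (x + h)"
        using normals_inner_le c x by blast
      ultimately have "c \<bullet> h = 0"
        by (simp add: inner_add_right)
      then show "c \<in> {c \<in> normals p U x. c \<bullet> h = 0}"
        using c by (simp add: normals_def inner_add_right)
    qed (auto simp: normals_def inner_add_right)
    then show ?case
      using elim(1) feasible by blast
  qed
qed

lemma eventually_chart:
  fixes p :: "'l \<Rightarrow> 'a::euclidean_space"
  assumes fin: "finite U" and "T \<subseteq> U" and x: "x \<in> rel_interior (convex hull (p ` T))"
  shows "\<forall>\<^sub>F h in nhds 0.
           (x + h \<in> convex hull (p ` U) \<longleftrightarrow> h \<in> tangent p U T) \<and>
           (x + h \<in> convex hull (p ` U) \<longrightarrow> carrier p U (x + h) = link p U T h)"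
proof -
  have xP: "x \<in> convex hull (p ` U)"
    using in_hull_if_rel_interior x \<open>T \<subseteq> U\<close> .
  have N: "normals p U x = {c. T \<subseteq> maximizers p U c}"
    using normals_at_rel_interior x \<open>T \<subseteq> U\<close> .
  show ?thesis
    using eventually_near_polytope_point [OF fin xP]
  proof eventually_elim
    case (elim h)
    then show ?case
      using carrier_eq_maximizers [OF fin, of "x + h" p] by (auto simp: N tangent_def link_def)
  qed
qed

lemma eventually_outside_polytope:
  fixes p :: "'l \<Rightarrow> 'a::euclidean_space"
  assumes "finite U" "x \<notin> convex hull (p ` U)"
  shows "\<forall>\<^sub>F h in nhds 0. x + h \<notin> convex hull (p ` U)"
proof -
  have "polytope (convex hull (p ` U))"
    using assms(1) by (simp add: polytope_convex_hull)
  then have "open (- (convex hull (p ` U)))"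
    by (simp add: polytope_imp_closed open_Compl)
  moreover have "((\<lambda>h. x + h) \<longlongrightarrow> x + 0) (nhds 0)"
    by (intro tendsto_intros filterlim_ident)
  ultimately show ?thesis
    using topological_tendstoD assms(2) by fastforce
qed

lemma eventually_nhds_0_multiple:
  fixes h :: "'a::real_normed_vector"
  assumes "\<forall>\<^sub>F h in nhds 0. P h"
  obtains t :: real where "t > 0" "P (t *\<^sub>R h)"
proof -
  have "((\<lambda>t::real. t *\<^sub>R h) \<longlongrightarrow> 0 *\<^sub>R h) (at_right 0)"
    by (intro tendsto_intros filterlim_ident)
  then have "\<forall>\<^sub>F t::real in at_right 0. P (t *\<^sub>R h)"
    using eventually_compose_filterlim [OF assms] by simp
  then have "\<forall>\<^sub>F t::real in at_right 0. t > 0 \<and> P (t *\<^sub>R h)"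
    using eventually_at_right_less by (rule eventually_elim2) auto
  then show thesis
    using that eventually_happens [of _ "at_right (0::real)"] by (auto simp: trivial_limit_at_right_real)
qed

text \<open>
  All normals at \<open>x\<close> vanish on the direction from a point of the carrier face to \<open>x\<close>; a short
  continuation beyond \<open>x\<close> stays in the polytope and has the same carrier.
\<close>

lemma rel_interior_carrier:
  fixes p :: "'l \<Rightarrow> 'a::euclidean_space"
  assumes fin: "finite U" and x: "x \<in> convex hull (p ` U)"
  shows "x \<in> rel_interior (convex hull (p ` carrier p U x))"
proof -
  let ?T = "carrier p U x"
  have xT: "x \<in> convex hull (p ` ?T)"
    by (rule in_hull_carrier [OF fin x])
  have "\<exists>e>1. (1 - e) *\<^sub>R y + e *\<^sub>R x \<in> convex hull (p ` ?T)" if y: "y \<in> convex hull (p ` ?T)" for y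
  proof -
    obtain t where t: "t > 0"
      and near: "(x + t *\<^sub>R (x - y) \<in> convex hull (p ` U) \<longleftrightarrow> (\<forall>c\<in>normals p U x. c \<bullet> (t *\<^sub>R (x - y)) \<le> 0)) \<and>
        (x + t *\<^sub>R (x - y) \<in> convex hull (p ` U) \<longrightarrow>
          normals p U (x + t *\<^sub>R (x - y)) = {c \<in> normals p U x. c \<bullet> (t *\<^sub>R (x - y)) = 0})"
      using eventually_nhds_0_multiple [OF eventually_near_polytope_point [OF fin x]] by blast
    have flat: "c \<bullet> (t *\<^sub>R (x - y)) = 0" if c: "c \<in> normals p U x" for c
    proof -
      have "c \<bullet> p v = c \<bullet> x" if "v \<in> ?T" for v
        using c that by (simp add: carrier_def)
      then have "c \<bullet> y \<le> c \<bullet> x" "(- c) \<bullet> y \<le> - (c \<bullet> x)"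
        by (auto intro!: hull_inner_le [OF y] simp del: inner_minus_left) (simp add: inner_minus_left)
      then show ?thesis
        by (simp add: inner_diff_right)
    qed
    have in_P: "x + t *\<^sub>R (x - y) \<in> convex hull (p ` U)"
      using near flat by (metis order_refl)
    then have "normals p U (x + t *\<^sub>R (x - y)) = normals p U x"
      using near flat by blast
    then have "carrier p U (x + t *\<^sub>R (x - y)) = ?T"
      using carrier_eq_maximizers [OF fin in_P] carrier_eq_maximizers [OF fin x] by simp
    then have "x + t *\<^sub>R (x - y) \<in> convex hull (p ` ?T)"
      using in_hull_carrier [OF fin in_P] by simp
    moreover have "x + t *\<^sub>R (x - y) = (1 - (1 + t)) *\<^sub>R y + (1 + t) *\<^sub>R x"
      by (simp add: algebra_simps)
    ultimately show ?thesis
      using t by (intro exI [of _ "1 + t"]) simp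
  qed
  then show ?thesis
    using xT by (subst convex_rel_interior_iff) auto
qed

lemma carrier_at_rel_interior:
  assumes "finite U" "T \<subseteq> U" "x \<in> rel_interior (convex hull (p ` T))"
  shows "carrier p U x = link p U T 0"
  using carrier_eq_maximizers [OF assms(1) in_hull_if_rel_interior [OF assms(3,2)]]
    normals_at_rel_interior [OF assms(3,2)]
  by (auto simp: link_def)

lemma carrier_subset_face:
  assumes "finite U" "G face_of convex hull (p ` U)" "x \<in> G"
  shows "p ` carrier p U x \<subseteq> G"
proof -
  have x: "x \<in> convex hull (p ` U)"
    using assms face_of_imp_subset by blast
  have "convex hull (p ` carrier p U x) \<subseteq> G"
  proof (rule subset_of_face_of [OF assms(2)])
    show "convex hull (p ` carrier p U x) \<subseteq> convex hull (p ` U)"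
      by (intro hull_mono image_mono carrier_subset)
    show "G \<inter> rel_interior (convex hull (p ` carrier p U x)) \<noteq> {}"
      using rel_interior_carrier [OF assms(1) x] assms(3) by blast
  qed
  then show ?thesis
    using hull_subset [of "p ` carrier p U x" convex] by order
qed

lemma hull_maximizers_face:
  fixes p :: "'l \<Rightarrow> 'a::euclidean_space"
  assumes fin: "finite U"
  shows "convex hull (p ` maximizers p U c) face_of convex hull (p ` U)"
proof (cases "U = {}")
  case True
  then show ?thesis
    by (simp add: maximizers_def)
next
  case False
  then obtain w where w: "w \<in> maximizers p U c"
    using maximizers_nonempty fin by blast
  let ?b = "c \<bullet> p w"
  have le: "c \<bullet> p v \<le> ?b" if "v \<in> U" for v
    using w that unfolding maximizers_def by blast
  have "convex hull (p ` U) \<inter> {x. c \<bullet> x = ?b} face_of convex hull (p ` U)"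
  proof (intro face_of_Int_supporting_hyperplane_le convex_convex_hull)
    show "c \<bullet> x \<le> ?b" if "x \<in> convex hull (p ` U)" for x
      using that by (rule hull_inner_le) (rule le)
  qed
  moreover have "convex hull (p ` U) \<inter> {x. c \<bullet> x = ?b} = convex hull (p ` maximizers p U c)"
  proof (intro subset_antisym subsetI)
    fix x assume x: "x \<in> convex hull (p ` U) \<inter> {x. c \<bullet> x = ?b}"
    then have "c \<in> normals p U x"
      using le by (simp add: normals_def)
    then have "carrier p U x \<subseteq> maximizers p U c"
      using normals_iff_carrier fin x by blast
    then show "x \<in> convex hull (p ` maximizers p U c)"
      using in_hull_carrier [OF fin] x by (meson IntD1 hull_mono image_mono subsetD)
  next
    have "p ` maximizers p U c \<subseteq> {x. c \<bullet> x = ?b}"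
      using w by (force simp: maximizers_def)
    then have "convex hull (p ` maximizers p U c) \<subseteq> {x. c \<bullet> x = ?b}"
      by (intro hull_minimal) (auto simp: convex_hyperplane)
    moreover have "convex hull (p ` maximizers p U c) \<subseteq> convex hull (p ` U)"
      by (intro hull_mono image_mono) (auto simp: maximizers_def)
    ultimately show "x \<in> convex hull (p ` U) \<inter> {x. c \<bullet> x = ?b}"
      if "x \<in> convex hull (p ` maximizers p U c)" for x
      using that by blast
  qed
  ultimately show ?thesis
    by simp
qed

text \<open>
  The linear forms maximized by every label form the orthogonal complement of the direction space
  of the affine hull.
\<close>

lemma aff_dim_hull_eq_if_same_maximizers:
  fixes p q :: "'l \<Rightarrow> 'a::euclidean_space"
  assumes same: "\<And>c. maximizers p U c = maximizers q U c"
  shows "aff_dim (convex hull (p ` U)) = aff_dim (convex hull (q ` U))"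
proof (cases "U = {}")
  case False
  then obtain w where w: "w \<in> U"
    by blast
  define N where "N = {c. U \<subseteq> maximizers p U c}"
  have dim: "aff_dim (convex hull (f ` U)) = int DIM('a) - int (dim N)"
    if N: "\<And>c. c \<in> N \<longleftrightarrow> U \<subseteq> maximizers f U c" for f :: "'l \<Rightarrow> 'a"
  proof -
    let ?D = "(\<lambda>v. f v - f w) ` U"
    have "c \<in> N \<longleftrightarrow> (\<forall>v\<in>U. c \<bullet> f v = c \<bullet> f w)" for c
    proof
      show "\<forall>v\<in>U. c \<bullet> f v = c \<bullet> f w" if "c \<in> N"
        using that w unfolding N maximizers_def by (blast intro: antisym)
      show "c \<in> N" if "\<forall>v\<in>U. c \<bullet> f v = c \<bullet> f w"
        using that unfolding N maximizers_def by auto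
    qed
    then have "N = {c \<in> UNIV. \<forall>x\<in>?D. orthogonal x c}"
      by (auto simp: orthogonal_def inner_diff_left inner_diff_right inner_commute)
    also have "\<dots> = {c \<in> UNIV. \<forall>x\<in>span ?D. orthogonal x c}"
    proof (intro Collect_cong conj_cong refl iffI ballI)
      show "orthogonal x c" if "\<forall>x\<in>?D. orthogonal x c" "x \<in> span ?D" for x c
      proof -
        have "orthogonal c y" if "y \<in> ?D" for y
          using \<open>\<forall>x\<in>?D. orthogonal x c\<close> that orthogonal_commute by blast
        then have "orthogonal c x"
          by (rule orthogonal_to_span [OF that(2)])
        then show ?thesis
          by (rule orthogonal_commute [THEN iffD1])
      qed
      show "orthogonal x c" if "\<forall>x\<in>span ?D. orthogonal x c" "x \<in> ?D" for x c
        using that(1) span_base [OF that(2)] by (rule bspec)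
    qed
    finally have "dim N + dim (span ?D) = DIM('a)"
      using dim_subspace_orthogonal_to_vectors [of "span ?D" UNIV] by simp
    moreover have "aff_dim (convex hull (f ` U)) = int (dim ?D)"
      using aff_dim_eq_dim [of "f w" "f ` U"] w hull_inc [of "f w" "f ` U" affine]
      by (simp add: aff_dim_convex_hull image_image)
    ultimately show ?thesis
      by simp
  qed
  show ?thesis
    using dim [of p] dim [of q] same by (simp add: N_def)
qed simp

section \<open>Deforming a subdivision\<close>

lemma card_eq_if_perfect_matching:
  assumes "\<And>x. x \<in> A \<Longrightarrow> \<exists>!y. y \<in> B \<and> R x y" "\<And>y. y \<in> B \<Longrightarrow> \<exists>!x. x \<in> A \<and> R x y"
  shows "card A = card B"
proof -
  define f where "f x = (THE y. y \<in> B \<and> R x y)" for x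
  have f: "f x \<in> B \<and> R x (f x)" if "x \<in> A" for x
    unfolding f_def by (rule theI' [OF assms(1) [OF that]])
  have "bij_betw f A B"
  proof (rule bij_betwI')
    show "f x = f y \<longleftrightarrow> x = y" if "x \<in> A" "y \<in> A" for x y
      using f that assms(2) by metis
    show "\<exists>x\<in>A. y = f x" if "y \<in> B" for y
      using f that assms by metis
  qed (use f in blast)
  then show ?thesis
    by (rule bij_betw_same_card)
qed

text \<open>
  The points \<open>p w\<close> and \<open>q w\<close> are two realizations of the labels with the same labelled normal fans,
  and the cells \<open>U i\<close> subdivide \<open>S\<close> in the realization \<open>p\<close>. The goal is a subdivision in the
  realization \<open>q\<close>. Convex position makes it possible to tell from the point with label \<open>w\<close> which
  cells have \<open>w\<close> among their labels.
\<close>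

locale subdivision_deformation =
  fixes p q :: "'l \<Rightarrow> 'a::euclidean_space" and S :: "'l set"
    and I :: "'i set" and U :: "'i \<Rightarrow> 'l set"
  assumes finite_I: "finite I" and finite_S: "finite S" and S_nonempty: "S \<noteq> {}"
    and U_subset: "i \<in> I \<Longrightarrow> U i \<subseteq> S"
    and same_S: "maximizers p S c = maximizers q S c"
    and same_U: "i \<in> I \<Longrightarrow> maximizers p (U i) c = maximizers q (U i) c"
    and convex_position_p: "w \<in> S \<Longrightarrow> X \<subseteq> S \<Longrightarrow> p w \<in> convex hull (p ` X) \<Longrightarrow> w \<in> X"
    and convex_position_q: "w \<in> S \<Longrightarrow> X \<subseteq> S \<Longrightarrow> q w \<in> convex hull (q ` X) \<Longrightarrow> w \<in> X"
    and cover_p: "convex hull (p ` S) \<subseteq> (\<Union>i\<in>I. convex hull (p ` U i))"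
    and face_p: "i \<in> I \<Longrightarrow> j \<in> I \<Longrightarrow>
      convex hull (p ` U i) \<inter> convex hull (p ` U j) face_of convex hull (p ` U i)"
begin

lemma finite_U: "i \<in> I \<Longrightarrow> finite (U i)"
  using U_subset finite_S finite_subset by blast

lemma tangent_eq: "i \<in> I \<Longrightarrow> tangent p (U i) T = tangent q (U i) T"
  by (simp add: tangent_def same_U)

lemma link_eq: "i \<in> I \<Longrightarrow> link p (U i) T h = link q (U i) T h"
  by (simp add: link_def same_U)

text \<open>
  Let \<open>c\<close> be a normal of the cell \<open>U j\<close> at \<open>x\<close>. Inside the common face of the two cells it cuts out
  a face of the cell \<open>U i\<close> around \<open>x\<close>, and such a face contains all points of the carrier.
\<close>

lemma carrier_p_subset:
  assumes ij: "i \<in> I" "j \<in> I" and x: "x \<in> convex hull (p ` U i)" "x \<in> convex hull (p ` U j)"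
  shows "carrier p (U i) x \<subseteq> carrier p (U j) x"
proof
  let ?F = "convex hull (p ` U i) \<inter> convex hull (p ` U j)"
  fix w assume w: "w \<in> carrier p (U i) x"
  then have wS: "w \<in> S"
    using U_subset [OF ij(1)] unfolding carrier_def by blast
  have "c \<bullet> p w = c \<bullet> x" and pw: "p w \<in> convex hull (p ` U j)" if c: "c \<in> normals p (U j) x" for c
  proof -
    have "?F \<inter> {z. c \<bullet> z = c \<bullet> x} face_of ?F"
      by (intro face_of_Int_supporting_hyperplane_le convex_Int convex_convex_hull)
        (blast intro: normals_inner_le [OF c])
    then have "?F \<inter> {z. c \<bullet> z = c \<bullet> x} face_of convex hull (p ` U i)"
      using face_p [OF ij] by (rule face_of_trans)
    then have "p ` carrier p (U i) x \<subseteq> ?F \<inter> {z. c \<bullet> z = c \<bullet> x}"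
      using x by (intro carrier_subset_face finite_U ij(1)) auto
    then show "c \<bullet> p w = c \<bullet> x" "p w \<in> convex hull (p ` U j)"
      using w by blast+
  qed
  moreover have "(0::'a) \<in> normals p (U j) x"
    by (simp add: normals_def)
  ultimately show "w \<in> carrier p (U j) x"
    using convex_position_p [OF wS U_subset [OF ij(2)]] unfolding carrier_def by blast
qed

lemma carrier_p_unique:
  assumes "i \<in> I" "j \<in> I" "x \<in> convex hull (p ` U i)" "x \<in> convex hull (p ` U j)"
  shows "carrier p (U i) x = carrier p (U j) x"
  using carrier_p_subset assms by (metis subset_antisym)

text \<open>
  Cells with the same carrier at \<open>x\<close> count as one sheet over \<open>x\<close>. In a subdivision there is exactly
  one sheet over each point; for the cells realized by \<open>q\<close> this is what has to be proved.
\<close>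

definition sheets :: "'a \<Rightarrow> 'l set set" where
  "sheets x = (\<lambda>i. carrier q (U i) x) ` {i \<in> I. x \<in> convex hull (q ` U i)}"

lemma sheet_nonempty:
  assumes "T \<in> sheets x" shows "T \<noteq> {}"
proof -
  obtain i where "i \<in> I" "x \<in> convex hull (q ` U i)" "T = carrier q (U i) x"
    using assms unfolding sheets_def by blast
  then show ?thesis
    using in_hull_carrier [OF finite_U, of i x q] by auto
qed

lemma sheet_rel_interior:
  assumes "T \<in> sheets x" shows "x \<in> rel_interior (convex hull (q ` T))"
proof -
  obtain i where "i \<in> I" "x \<in> convex hull (q ` U i)" "T = carrier q (U i) x"
    using assms unfolding sheets_def by blast
  then show ?thesis
    using rel_interior_carrier [OF finite_U] by simp
qed

text \<open>
  All cells whose labels include a sheet see that sheet as the carrier. This is a statement about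
  the normal fans, so it can be checked in the realization \<open>p\<close>, at a relative interior point of the
  hull of these labels.
\<close>

lemma carrier_q_at_sheet:
  assumes T: "T \<in> sheets x" and j: "j \<in> I" "T \<subseteq> U j"
  shows "x \<in> convex hull (q ` U j)" and "carrier q (U j) x = T"
proof -
  have x: "x \<in> rel_interior (convex hull (q ` T))"
    by (rule sheet_rel_interior [OF T])
  then show "x \<in> convex hull (q ` U j)"
    by (rule in_hull_if_rel_interior [OF _ j(2)])
  obtain i where i: "i \<in> I" "T = carrier q (U i) x"
    using T unfolding sheets_def by blast
  then have Ti: "T \<subseteq> U i"
    by (simp add: carrier_subset)
  have "rel_interior (convex hull (p ` T)) \<noteq> {}"
    using sheet_nonempty [OF T] by (simp add: rel_interior_eq_empty)
  then obtain y where y: "y \<in> rel_interior (convex hull (p ` T))"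
    by blast
  have "carrier q (U j) x = link q (U j) T 0"
    by (rule carrier_at_rel_interior [OF finite_U [OF j(1)] j(2) x])
  also have "\<dots> = carrier p (U j) y"
    using carrier_at_rel_interior [OF finite_U [OF j(1)] j(2) y] link_eq [OF j(1)] by simp
  also have "\<dots> = carrier p (U i) y"
    by (intro carrier_p_unique j(1) i(1) in_hull_if_rel_interior [OF y] j(2) Ti)
  also have "\<dots> = link q (U i) T 0"
    using carrier_at_rel_interior [OF finite_U [OF i(1)] Ti y] link_eq [OF i(1)] by simp
  also have "\<dots> = T"
    using carrier_at_rel_interior [OF finite_U [OF i(1)] Ti x] i(2) by simp
  finally show "carrier q (U j) x = T" .
qed

text \<open>
  The displacement \<open>h\<close> is so small that at \<open>x + h\<close> the tangent cones and links at \<open>x\<close> describe all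
  cells containing \<open>x\<close>, and no other cell is met.
\<close>

definition chart_at :: "'a \<Rightarrow> 'a \<Rightarrow> bool" where
  "chart_at x h \<longleftrightarrow> (\<forall>j\<in>I.
     if x \<in> convex hull (q ` U j) then
       (x + h \<in> convex hull (q ` U j) \<longleftrightarrow> h \<in> tangent q (U j) (carrier q (U j) x)) \<and>
       (x + h \<in> convex hull (q ` U j) \<longrightarrow>
         carrier q (U j) (x + h) = link q (U j) (carrier q (U j) x) h)
     else x + h \<notin> convex hull (q ` U j))"

lemma eventually_chart_at: "\<forall>\<^sub>F h in nhds 0. chart_at x h"
  unfolding chart_at_def
proof (rule eventually_ball_finite [OF finite_I], rule ballI)
  fix j assume j: "j \<in> I"
  show "\<forall>\<^sub>F h in nhds 0.
     if x \<in> convex hull (q ` U j) then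
       (x + h \<in> convex hull (q ` U j) \<longleftrightarrow> h \<in> tangent q (U j) (carrier q (U j) x)) \<and>
       (x + h \<in> convex hull (q ` U j) \<longrightarrow>
         carrier q (U j) (x + h) = link q (U j) (carrier q (U j) x) h)
     else x + h \<notin> convex hull (q ` U j)"
  proof (cases "x \<in> convex hull (q ` U j)")
    case True
    then show ?thesis
      using eventually_chart [OF finite_U [OF j] carrier_subset rel_interior_carrier [OF finite_U [OF j] True]]
      by simp
  next
    case False
    then show ?thesis
      using eventually_outside_polytope [OF finite_U [OF j] False] by simp
  qed
qed

text \<open>
  The cells around \<open>T\<close> have the same tangent cones in both realizations. In the realization \<open>p\<close>
  they subdivide the tangent cone of the whole polytope, so they do in the realization \<open>q\<close>,
  whatever the other sheets over \<open>x\<close> may be.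
\<close>

lemma sheet_continues_uniquely:
  assumes T: "T \<in> sheets x" and h: "chart_at x h" and y: "x + h \<in> convex hull (q ` S)"
  shows "\<exists>!T'. T' \<in> sheets (x + h) \<and> T \<subseteq> T'"
proof -
  have x: "x \<in> rel_interior (convex hull (q ` T))"
    by (rule sheet_rel_interior [OF T])
  obtain i where i: "i \<in> I" "T = carrier q (U i) x"
    using T unfolding sheets_def by blast
  then have Ti: "T \<subseteq> U i"
    by (simp add: carrier_subset)
  have TS: "T \<subseteq> S"
    using Ti U_subset [OF i(1)] by (rule subset_trans)
  have "rel_interior (convex hull (p ` T)) \<noteq> {}"
    using sheet_nonempty [OF T] by (simp add: rel_interior_eq_empty)
  then obtain z where z: "z \<in> rel_interior (convex hull (p ` T))"
    by blast
  \<comment> \<open>These displacements are short enough for the same analysis around \<open>z\<close> in the realization \<open>p\<close>.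
      Some positive multiple of \<open>h\<close> is among them, and tangent cones and links ignore the factor.\<close>
  define good where "good k \<longleftrightarrow> (z + k \<in> convex hull (p ` S) \<longleftrightarrow> k \<in> tangent p S T) \<and>
     (\<forall>j\<in>I. if T \<subseteq> U j
        then (z + k \<in> convex hull (p ` U j) \<longleftrightarrow> k \<in> tangent p (U j) T) \<and>
          (z + k \<in> convex hull (p ` U j) \<longrightarrow> carrier p (U j) (z + k) = link p (U j) T k)
        else z + k \<notin> convex hull (p ` U j))" for k
  have "\<forall>\<^sub>F k in nhds 0. good k"
    unfolding good_def
  proof (intro eventually_conj eventually_ball_finite [OF finite_I] ballI)
    show "\<forall>\<^sub>F k in nhds 0. z + k \<in> convex hull (p ` S) \<longleftrightarrow> k \<in> tangent p S T"
      using eventually_chart [OF finite_S TS z] by eventually_elim blast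
    fix j assume j: "j \<in> I"
    show "\<forall>\<^sub>F k in nhds 0. if T \<subseteq> U j
        then (z + k \<in> convex hull (p ` U j) \<longleftrightarrow> k \<in> tangent p (U j) T) \<and>
          (z + k \<in> convex hull (p ` U j) \<longrightarrow> carrier p (U j) (z + k) = link p (U j) T k)
        else z + k \<notin> convex hull (p ` U j)"
    proof (cases "T \<subseteq> U j")
      case True
      then show ?thesis
        using eventually_chart [OF finite_U [OF j] True z] by simp
    next
      case False
      have "z \<notin> convex hull (p ` U j)"
      proof
        assume zj: "z \<in> convex hull (p ` U j)"
        have "T = link q (U i) T 0"
          using carrier_at_rel_interior [OF finite_U [OF i(1)] Ti x] i(2) by simp
        also have "\<dots> = carrier p (U i) z"
          using carrier_at_rel_interior [OF finite_U [OF i(1)] Ti z] link_eq [OF i(1)] by simp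
        also have "\<dots> = carrier p (U j) z"
          by (rule carrier_p_unique [OF i(1) j in_hull_if_rel_interior [OF z Ti] zj])
        finally show False
          using False by (simp add: carrier_subset)
      qed
      then show ?thesis
        using False eventually_outside_polytope [OF finite_U [OF j]] by simp
    qed
  qed
  then obtain t where t: "t > 0" "good (t *\<^sub>R h)"
    by (rule eventually_nhds_0_multiple)
  have tangent_scale: "t *\<^sub>R h \<in> tangent p V T \<longleftrightarrow> h \<in> tangent p V T" for V
    using t(1) by (simp add: tangent_def mult_le_0_iff)
  have link_scale: "link p V T (t *\<^sub>R h) = link p V T h" for V
    using t(1) by (simp add: link_def)
  let ?z = "z + t *\<^sub>R h"
  have transfer: "x + h \<in> convex hull (q ` U j) \<longleftrightarrow> ?z \<in> convex hull (p ` U j)"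
    "x + h \<in> convex hull (q ` U j) \<Longrightarrow> carrier q (U j) (x + h) = carrier p (U j) ?z"
    if j: "j \<in> I" "T \<subseteq> U j" for j
  proof -
    have chart_p: "?z \<in> convex hull (p ` U j) \<longleftrightarrow> h \<in> tangent p (U j) T"
      "?z \<in> convex hull (p ` U j) \<Longrightarrow> carrier p (U j) ?z = link p (U j) T h"
      using t(2) j unfolding good_def tangent_scale link_scale by simp_all
    have chart_q: "x + h \<in> convex hull (q ` U j) \<longleftrightarrow> h \<in> tangent q (U j) T"
      "x + h \<in> convex hull (q ` U j) \<Longrightarrow> carrier q (U j) (x + h) = link q (U j) T h"
      using h j(1) carrier_q_at_sheet [OF T j] unfolding chart_at_def by auto
    show "x + h \<in> convex hull (q ` U j) \<longleftrightarrow> ?z \<in> convex hull (p ` U j)"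
      "x + h \<in> convex hull (q ` U j) \<Longrightarrow> carrier q (U j) (x + h) = carrier p (U j) ?z"
      using chart_p chart_q tangent_eq [OF j(1)] link_eq [OF j(1)] by auto
  qed
  have "h \<in> tangent q S T"
  proof -
    have "c \<bullet> h \<le> 0" if "T \<subseteq> maximizers q S c" for c
    proof -
      have "c \<in> normals q S x"
        using in_hull_if_rel_interior [OF x subset_refl] that by (rule normals_if_subset_maximizers)
      then have "c \<bullet> (x + h) \<le> c \<bullet> x"
        using y by (rule normals_inner_le)
      then show ?thesis
        by (simp add: inner_add_right)
    qed
    then show ?thesis
      by (simp add: tangent_def)
  qed
  then have "t *\<^sub>R h \<in> tangent p S T"
    unfolding tangent_scale by (simp add: tangent_def same_S)
  then have "?z \<in> convex hull (p ` S)"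
    using t(2) unfolding good_def by blast
  then obtain j where j: "j \<in> I" "?z \<in> convex hull (p ` U j)"
    using cover_p by blast
  have Tj: "T \<subseteq> U j"
  proof (rule ccontr)
    assume "\<not> T \<subseteq> U j"
    then have "?z \<notin> convex hull (p ` U j)"
      using t(2) j(1) unfolding good_def by simp
    then show False
      using j(2) by contradiction
  qed
  have yj: "x + h \<in> convex hull (q ` U j)"
    using transfer(1) [OF j(1) Tj] j(2) by simp
  show ?thesis
  proof (rule ex1I [of _ "carrier q (U j) (x + h)"])
    have "carrier q (U j) (x + h) = link q (U j) T h"
      using h j(1) yj carrier_q_at_sheet [OF T j(1) Tj] unfolding chart_at_def by auto
    then have "T \<subseteq> carrier q (U j) (x + h)"
      using Tj by (auto simp: link_def)
    then show "carrier q (U j) (x + h) \<in> sheets (x + h) \<and> T \<subseteq> carrier q (U j) (x + h)"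
      using j(1) yj by (auto simp: sheets_def)
  next
    fix T' assume T': "T' \<in> sheets (x + h) \<and> T \<subseteq> T'"
    then obtain k where k: "k \<in> I" "x + h \<in> convex hull (q ` U k)" "T' = carrier q (U k) (x + h)"
      unfolding sheets_def by blast
    then have Tk: "T \<subseteq> U k"
      using T' carrier_subset [of q "U k"] by blast
    have "T' = carrier p (U k) ?z"
      using transfer(2) [OF k(1) Tk k(2)] k(3) by simp
    also have "\<dots> = carrier p (U j) ?z"
      using transfer(1) [OF k(1) Tk] k(2) by (intro carrier_p_unique k(1) j) simp
    also have "\<dots> = carrier q (U j) (x + h)"
      using transfer(2) [OF j(1) Tj yj] by simp
    finally show "T' = carrier q (U j) (x + h)" .
  qed
qed

lemma sheet_restricts_uniquely:
  assumes T': "T' \<in> sheets (x + h)" and h: "chart_at x h"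
  shows "\<exists>!T. T \<in> sheets x \<and> T \<subseteq> T'"
proof -
  obtain j where j: "j \<in> I" "x + h \<in> convex hull (q ` U j)" "T' = carrier q (U j) (x + h)"
    using T' unfolding sheets_def by blast
  have xj: "x \<in> convex hull (q ` U j)"
  proof (rule ccontr)
    assume "x \<notin> convex hull (q ` U j)"
    then show False
      using h j(1,2) unfolding chart_at_def by simp
  qed
  then have link: "T' = link q (U j) (carrier q (U j) x) h"
    using h j unfolding chart_at_def by simp
  show ?thesis
  proof (rule ex1I [of _ "carrier q (U j) x"])
    show "carrier q (U j) x \<in> sheets x \<and> carrier q (U j) x \<subseteq> T'"
      using xj j(1) carrier_subset [of q "U j" x] unfolding link by (auto simp: sheets_def link_def)
    show "T = carrier q (U j) x" if "T \<in> sheets x \<and> T \<subseteq> T'" for T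
      using that carrier_q_at_sheet(2) [of T x j] j(1) carrier_subset [of q "U j" "x + h"] j(3) by auto
  qed
qed

text \<open>
  By convex position, the cells that contain the vertex labelled \<open>w\<close> are the same in both
  realizations, and they agree about the carrier for \<open>p\<close>.
\<close>

lemma card_sheets_vertex:
  assumes w: "w \<in> S"
  shows "card (sheets (q w)) = 1"
proof -
  have sheet: "carrier q (U j) (q w) = carrier p (U j) (p w)" if j: "j \<in> I" "w \<in> U j" for j
    using carrier_at_rel_interior [OF finite_U [OF j(1)], of "{w}" "q w" q] j
      carrier_at_rel_interior [OF finite_U [OF j(1)], of "{w}" "p w" p] link_eq [OF j(1)]
    by simp
  have "p w \<in> convex hull (p ` S)"
    using w by (simp add: hull_inc)
  then obtain i where i: "i \<in> I" "p w \<in> convex hull (p ` U i)"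
    using cover_p by blast
  then have wi: "w \<in> U i"
    using convex_position_p [OF w U_subset] by blast
  have "sheets (q w) = {carrier p (U i) (p w)}"
  proof (intro subset_antisym subsetI)
    fix T assume "T \<in> sheets (q w)"
    then obtain j where j: "j \<in> I" "q w \<in> convex hull (q ` U j)" "T = carrier q (U j) (q w)"
      unfolding sheets_def by blast
    then have wj: "w \<in> U j"
      using convex_position_q [OF w U_subset] by blast
    then have "T = carrier p (U j) (p w)" "p w \<in> convex hull (p ` U j)"
      using sheet j by (simp_all add: hull_inc)
    then show "T \<in> {carrier p (U i) (p w)}"
      using carrier_p_unique [OF j(1) i(1) _ i(2)] by simp
  next
    have "q w \<in> convex hull (q ` U i)"
      using wi by (simp add: hull_inc)
    then show "T \<in> sheets (q w)" if "T \<in> {carrier p (U i) (p w)}" for T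
      using that i(1) sheet [OF i(1) wi] unfolding sheets_def by blast
  qed
  then show ?thesis
    by simp
qed

text \<open>
  Sheets continue and restrict uniquely, so their number is locally constant on the connected
  polytope and can be counted at a vertex.
\<close>

lemma card_sheets:
  assumes x: "x \<in> convex hull (q ` S)"
  shows "card (sheets x) = 1"
proof -
  let ?P = "convex hull (q ` S)"
  obtain w where w: "w \<in> S"
    using S_nonempty by blast
  have "card (sheets x) = card (sheets (q w))"
  proof (rule connected_local_const [OF convex_connected [OF convex_convex_hull] x])
    show "q w \<in> ?P"
      using w by (simp add: hull_inc)
    show "\<forall>x\<in>?P. \<forall>\<^sub>F y in at x within ?P. card (sheets x) = card (sheets y)"
    proof
      fix x assume "x \<in> ?P"
      have "((\<lambda>y. y - x) \<longlongrightarrow> x - x) (at x within ?P)"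
        by (intro tendsto_intros)
      then have "\<forall>\<^sub>F y in at x within ?P. chart_at x (y - x)"
        using eventually_compose_filterlim [OF eventually_chart_at [of x]] by simp
      moreover have "\<forall>\<^sub>F y in at x within ?P. y \<in> ?P"
        by (simp add: eventually_at_topological, blast)
      ultimately show "\<forall>\<^sub>F y in at x within ?P. card (sheets x) = card (sheets y)"
      proof eventually_elim
        case (elim y)
        then show ?case
          using sheet_continues_uniquely [of _ x "y - x"] sheet_restricts_uniquely [of _ x "y - x"]
          by (intro card_eq_if_perfect_matching [where R = "(\<subseteq>)"]) simp_all
      qed
    qed
  qed
  then show ?thesis
    using card_sheets_vertex w by simp
qed

lemma carrier_q_unique:
  assumes "i \<in> I" "j \<in> I" "x \<in> convex hull (q ` U i)" "x \<in> convex hull (q ` U j)"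
  shows "carrier q (U i) x = carrier q (U j) x"
proof -
  have "x \<in> convex hull (q ` S)"
    using hull_mono [OF image_mono [OF U_subset [OF assms(1)]]] assms(3) by (rule subsetD)
  then obtain T where "sheets x = {T}"
    using card_sheets [of x] by (metis card_1_singletonE)
  moreover have "carrier q (U i) x \<in> sheets x" "carrier q (U j) x \<in> sheets x"
    using assms unfolding sheets_def by blast+
  ultimately show ?thesis
    by simp
qed

lemma cover_q: "(\<Union>i\<in>I. convex hull (q ` U i)) = convex hull (q ` S)"
proof (intro subset_antisym subsetI)
  show "x \<in> convex hull (q ` S)" if "x \<in> (\<Union>i\<in>I. convex hull (q ` U i))" for x
    using that hull_mono [OF image_mono [OF U_subset], of _ convex q] by blast
next
  fix x assume "x \<in> convex hull (q ` S)"
  then have "sheets x \<noteq> {}"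
    using card_sheets [of x] by auto
  then show "x \<in> (\<Union>i\<in>I. convex hull (q ` U i))"
    unfolding sheets_def by blast
qed

lemma Int_hull_if_carriers_agree:
  assumes ij: "i \<in> I" "j \<in> I"
    and unique: "\<And>x. x \<in> convex hull (f ` U i) \<Longrightarrow> x \<in> convex hull (f ` U j) \<Longrightarrow>
      carrier f (U i) x = carrier f (U j) x"
  shows "convex hull (f ` U i) \<inter> convex hull (f ` U j) = convex hull (f ` (U i \<inter> U j))"
proof (intro subset_antisym subsetI)
  fix x assume x: "x \<in> convex hull (f ` U i) \<inter> convex hull (f ` U j)"
  then have "carrier f (U i) x \<subseteq> U i \<inter> U j"
    using unique [of x] carrier_subset [of f "U i" x] carrier_subset [of f "U j" x] by auto
  then have "convex hull (f ` carrier f (U i) x) \<subseteq> convex hull (f ` (U i \<inter> U j))"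
    by (intro hull_mono image_mono)
  then show "x \<in> convex hull (f ` (U i \<inter> U j))"
    using in_hull_carrier [OF finite_U [OF ij(1)], of x f] x by blast
next
  show "x \<in> convex hull (f ` U i) \<inter> convex hull (f ` U j)" if "x \<in> convex hull (f ` (U i \<inter> U j))" for x
    using that hull_mono [OF image_mono [OF Int_lower1], of convex f "U i" "U j"]
      hull_mono [OF image_mono [OF Int_lower2], of convex f "U i" "U j"] by blast
qed

text \<open>
  The intersection of two cells is the hull of their common labels. In the realization \<open>p\<close> it is
  exposed by some \<open>c\<close>, so the common labels are the maximizers of \<open>c\<close>, in both realizations.
\<close>

lemma face_q:
  assumes ij: "i \<in> I" "j \<in> I"
  shows "convex hull (q ` U i) \<inter> convex hull (q ` U j) face_of convex hull (q ` U i)"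
proof -
  let ?R = "U i \<inter> U j"
  have p_Int: "convex hull (p ` U i) \<inter> convex hull (p ` U j) = convex hull (p ` ?R)"
    by (intro Int_hull_if_carriers_agree ij carrier_p_unique)
  have q_Int: "convex hull (q ` U i) \<inter> convex hull (q ` U j) = convex hull (q ` ?R)"
    by (intro Int_hull_if_carriers_agree ij carrier_q_unique)
  show ?thesis
  proof (cases "?R = {}")
    case True
    then show ?thesis
      unfolding q_Int by simp
  next
    case False
    have "polyhedron (convex hull (p ` U i))"
      using finite_U ij by (simp add: polytope_imp_polyhedron polytope_convex_hull)
    then have "convex hull (p ` ?R) exposed_face_of convex hull (p ` U i)"
      using face_p [OF ij] unfolding p_Int by (rule exposed_face_of_polyhedron [THEN iffD2])
    then obtain c b where le: "convex hull (p ` U i) \<subseteq> {x. c \<bullet> x \<le> b}"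
      and eq: "convex hull (p ` ?R) = convex hull (p ` U i) \<inter> {x. c \<bullet> x = b}"
      unfolding exposed_face_of_def by blast
    have le': "c \<bullet> p v \<le> b" if "v \<in> U i" for v
      using that le hull_inc [of "p v" "p ` U i" convex] by blast
    have eq': "c \<bullet> p v = b" if "v \<in> ?R" for v
      using that eq hull_inc [of "p v" "p ` ?R" convex] by blast
    have "maximizers p (U i) c = ?R"
    proof (intro subset_antisym subsetI)
      fix v assume v: "v \<in> maximizers p (U i) c"
      then have vi: "v \<in> U i"
        by (simp add: maximizers_def)
      obtain w where w: "w \<in> ?R"
        using False by blast
      then have "c \<bullet> p w \<le> c \<bullet> p v"
        using v by (simp add: maximizers_def)
      then have "c \<bullet> p v = b"
        using eq' [OF w] le' [OF vi] by simp
      then have "p v \<in> convex hull (p ` ?R)"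
        unfolding eq using vi by (simp add: hull_inc)
      then show "v \<in> ?R"
        using convex_position_p [of v ?R] vi U_subset [OF ij(1)] by blast
    qed (use le' eq' in \<open>auto simp: maximizers_def\<close>)
    then have "maximizers q (U i) c = ?R"
      using same_U [OF ij(1)] by simp
    then show ?thesis
      unfolding q_Int using hull_maximizers_face [OF finite_U [OF ij(1)], of q c] by simp
  qed
qed

end

section \<open>Persistence of subdivisions\<close>

theorem theorem7p7:
  fixes W :: "(real ^ 'n \<Rightarrow> real ^ 'n) set"
    and \<Phi> B :: "(real ^ 'n) set"
    and a :: "real ^ 'n"
    and S :: "(real ^ 'n \<Rightarrow> real ^ 'n) set"
    and r :: nat
    and \<Theta> :: "nat \<Rightarrow> (real ^ 'n \<Rightarrow> real ^ 'n) set"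
  assumes "finite_reflection_group W"
    and "root_system_of W \<Phi>"
    and "open_chamber \<Phi> B"
    and "a \<in> B"
    and "S \<noteq> {}" and "S \<subseteq> W"
    and "\<And>i. i \<in> {1..r} \<Longrightarrow> \<Theta> i \<noteq> {}" and "\<And>i. i \<in> {1..r} \<Longrightarrow> \<Theta> i \<subseteq> W"
    and "matroid_polytope W \<Phi> B (orbit_polytope S a)"
    and "\<And>i. i \<in> {1..r} \<Longrightarrow> matroid_polytope W \<Phi> B (orbit_polytope (\<Theta> i) a)"
  shows "orbit_subdivision a r \<Theta> S \<longleftrightarrow> persistent_subdivision B r \<Theta> S"
proof
  assume "persistent_subdivision B r \<Theta> S"
  then show "orbit_subdivision a r \<Theta> S"
    using \<open>a \<in> B\<close> by (simp add: persistent_subdivision_def)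
next
  assume sub: "orbit_subdivision a r \<Theta> S"
  have rs: "root_system \<Phi>" and W: "W = reflection_group \<Phi>" and fin: "finite W"
    using assms(1,2) by (auto simp: root_system_of_def finite_reflection_group_def)
  interpret chamber_of_reflection_group W \<Phi> B
    using rs W fin assms(3) by unfold_locales
  have cover: "(\<Union>i\<in>{1..r}. orbit_polytope (\<Theta> i) a) = orbit_polytope S a"
    and dim: "\<And>i. i \<in> {1..r} \<Longrightarrow> aff_dim (orbit_polytope (\<Theta> i) a) = aff_dim (orbit_polytope S a)"
    and face: "\<And>i j. i \<in> {1..r} \<Longrightarrow> j \<in> {1..r} \<Longrightarrow>
      orbit_polytope (\<Theta> i) a \<inter> orbit_polytope (\<Theta> j) a face_of orbit_polytope (\<Theta> i) a"
    using sub unfolding orbit_subdivision_def subdivision_def by auto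
  have \<Theta>S: "\<Theta> i \<subseteq> S" if i: "i \<in> {1..r}" for i
  proof
    fix w assume w: "w \<in> \<Theta> i"
    then have "w a \<in> orbit_polytope (\<Theta> i) a"
      by (simp add: orbit_polytope_def hull_inc)
    then have "w a \<in> orbit_polytope S a"
      using cover i by blast
    then show "w \<in> S"
      using convex_position_orbit [OF \<open>a \<in> B\<close> _ \<open>S \<subseteq> W\<close>] w assms(8) [OF i]
      unfolding orbit_polytope_def by blast
  qed
  show "persistent_subdivision B r \<Theta> S"
    unfolding persistent_subdivision_def
  proof
    fix b assume b: "b \<in> B"
    have same_S: "maximizers (\<lambda>w. w a) S c = maximizers (\<lambda>w. w b) S c" for c
      using maximizers_constant_on_chamber [OF \<open>S \<subseteq> W\<close> \<open>a \<in> B\<close> b] assms(9)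
      by (simp add: matroid_polytope_def)
    have same_\<Theta>: "maximizers (\<lambda>w. w a) (\<Theta> i) c = maximizers (\<lambda>w. w b) (\<Theta> i) c"
      if "i \<in> {1..r}" for i c
      using maximizers_constant_on_chamber [OF assms(8) [OF that] \<open>a \<in> B\<close> b] assms(10) [OF that]
      by (simp add: matroid_polytope_def)
    have finS: "finite S"
      using fin \<open>S \<subseteq> W\<close> by (rule finite_subset [rotated])
    interpret subdivision_deformation "\<lambda>w. w a" "\<lambda>w. w b" S "{1..r}" \<Theta>
    proof (rule subdivision_deformation.intro)
      show "w \<in> X" if "w \<in> S" "X \<subseteq> S" "w a \<in> convex hull ((\<lambda>w. w a) ` X)" for w X
        by (rule convex_position_orbit [OF \<open>a \<in> B\<close> subsetD [OF \<open>S \<subseteq> W\<close> that(1)]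
              subset_trans [OF that(2) \<open>S \<subseteq> W\<close>] that(3)])
      show "w \<in> X" if "w \<in> S" "X \<subseteq> S" "w b \<in> convex hull ((\<lambda>w. w b) ` X)" for w X
        by (rule convex_position_orbit [OF b subsetD [OF \<open>S \<subseteq> W\<close> that(1)]
              subset_trans [OF that(2) \<open>S \<subseteq> W\<close>] that(3)])
      show "convex hull ((\<lambda>w. w a) ` S) \<subseteq> (\<Union>i\<in>{1..r}. convex hull ((\<lambda>w. w a) ` \<Theta> i))"
        using cover unfolding orbit_polytope_def by (rule equalityD2)
      show "convex hull ((\<lambda>w. w a) ` \<Theta> i) \<inter> convex hull ((\<lambda>w. w a) ` \<Theta> j)
          face_of convex hull ((\<lambda>w. w a) ` \<Theta> i)" if "i \<in> {1..r}" "j \<in> {1..r}" for i j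
        using face [OF that] unfolding orbit_polytope_def .
    qed (rule finite_atLeastAtMost finS \<open>S \<noteq> {}\<close> \<Theta>S same_S same_\<Theta>, assumption?)+
    have dim_eq: "aff_dim (orbit_polytope V b) = aff_dim (orbit_polytope V a)"
      if "\<And>c. maximizers (\<lambda>w. w a) V c = maximizers (\<lambda>w. w b) V c" for V
      using aff_dim_hull_eq_if_same_maximizers [OF that] by (simp add: orbit_polytope_def)
    have "polytope (orbit_polytope V b)" if "V \<subseteq> S" for V
      unfolding orbit_polytope_def
      by (intro polytope_convex_hull finite_imageI finite_subset [OF that finS])
    moreover have "aff_dim (orbit_polytope (\<Theta> i) b) = aff_dim (orbit_polytope S b)"
      if "i \<in> {1..r}" for i
      using dim [OF that] dim_eq [OF same_S] dim_eq [OF same_\<Theta> [OF that]] by simp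
    moreover have "(\<Union>i\<in>{1..r}. orbit_polytope (\<Theta> i) b) = orbit_polytope S b"
      using cover_q by (simp add: orbit_polytope_def)
    moreover have "orbit_polytope (\<Theta> i) b \<inter> orbit_polytope (\<Theta> j) b face_of orbit_polytope (\<Theta> i) b"
      if "i \<in> {1..r}" "j \<in> {1..r}" for i j
      using face_q [OF that] by (simp add: orbit_polytope_def)
    moreover have "orbit_polytope (\<Theta> i) b \<inter> orbit_polytope (\<Theta> j) b face_of orbit_polytope (\<Theta> j) b"
      if "i \<in> {1..r}" "j \<in> {1..r}" for i j
      using face_q [OF that(2,1)] by (simp add: orbit_polytope_def Int_commute)
    ultimately show "orbit_subdivision b r \<Theta> S"
      using \<Theta>S unfolding orbit_subdivision_def subdivision_def by simp
  qed
qed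

end
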